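(* For every timed CEA $\mathcal{T}=(Q,\mathbf{P},\mathbf{X},\mathbf{Z},\Delta,q_0,F)$ with synchronous resets, there exists a deterministic timed CEA $\mathcal{T}'$ such that $[\![\mathcal{T}]\!](\bar S)=[\![\mathcal{T}']\!](\bar S)$ for every timed stream $\bar S$. Furthermore, $|\mathcal{T}'|\in\mathcal{O}(2^{|Q|+2|\Delta|}\cdot|\mathcal{T}|)$.
   Context: Events: partial finite-domain maps from attribute names to data values, each with a type; $\mathbf{E}$ is the set of all events. Predicates are subsets of $\mathbf{E}$; the fixed predicate set $\mathbf{P}$ is the closure of a set of basic predicates under intersection and complement and contains $\mathbf{E}$. Size of predicates: $|P|=1$ for basic $P$, $|P_1\cap P_2|=|P_1|+|P_2|$, $|\mathbf{E}\setminus P|=|P|+1$. A timed stream is $\bar S=(e_1,t_1)\cdots(e_n,t_n)$ with $t_i\in\mathbb{Q}_{\ge0}$ strictly increasing. $\mathbf{X}$ is a finite set of variables. A complex event is $(i,j,\mu)$ with $1\le i\le j\le n$ and $\mu:\mathbf{X}\to2^{\{i,\dots,j\}}$. Clock conditions over a finite clock set $\mathbf{Z}$: $\gamma::=\mathrm{true}\mid z\sim c\ (\sim\in\{=,<,\le,\ge,>\}, c\in\mathbb{Q}_{\ge0})\mid\gamma\wedge\gamma\mid\gamma\vee\gamma$; $|\gamma|$ is its number of operations; $\mathcal{C}_{\mathbf{Z}}$ is the set of all clock conditions. A clock valuation is a partial $\nu:\mathbf{Z}\to\mathbb{R}_{\ge0}$; $\nu\models\gamma$ iff all clocks of $\gamma$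 are defined under $\nu$ and $\gamma$ evaluates true; $\nu+t$ adds $t$ to every defined clock; $\mathrm{reset}_Z(\nu)$ has domain $\mathrm{dom}(\nu)\cup Z$, is $0$ on $Z$ and $\nu$ elsewhere. A timed CEA is $\mathcal{T}=(Q,\mathbf{P},\mathbf{X},\mathbf{Z},\Delta,q_0,F)$, $Q$ finite, $q_0\in Q$, $F\subseteq Q$, $\Delta\subseteq Q\times\mathbf{P}\times\mathcal{C}_{\mathbf{Z}}\times2^{\mathbf{X}}\times2^{\mathbf{Z}}\times Q$ finite. Its size is $|\mathcal{T}|=|Q|+\sum_{(p,P,\gamma,L,Z,q)\in\Delta}(|\gamma|+|P|+|L|+|Z|)$. With $\delta t_k=t_k-t_{k-1}$, $\delta t_1=t_1$, a run from position $i$ to $j$ is $(p_i,\nu_i)\xrightarrow{P_i,\gamma_i/L_i,Z_i}\cdots\xrightarrow{P_j,\gamma_j/L_j,Z_j}(p_{j+1},\nu_{j+1})$ with $p_i=q_0$, $\nu_i$ everywhere undefined, and for each $k\in[i..j]$: $(p_k,P_k,\gamma_k,L_k,Z_k,p_{k+1})\in\Delta$, $e_k\in P_k$, $\nu_k+\delta t_k\models\gamma_k$, $\nu_{k+1}=\mathrm{reset}_{Z_k}(\nu_k+\delta t_k)$. It is accepting if $p_{j+1}\in F$ and then outputs $(i,j,\mu)$ with $\mu(X)=\{k:X\in L_k\}$; $[\![\mathcal{T}]\!](\bar S)$ is the set of outputs of accepting runs. $\mathcal{T}$ is deterministic if for any two transitions $(p,P_1,\gamma_1,L_1,Z_1,q_1)$,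 $(p,P_2,\gamma_2,L_2,Z_2,q_2)$ in $\Delta$ (distinct) from the same state with $P_1\cap P_2\ne\emptyset$ and $\gamma_1\wedge\gamma_2$ satisfiable, we have $L_1\ne L_2$. $\mathcal{T}$ has synchronous resets if for every timed stream and every two runs (accepting or not) from the same position $i$ to the same position $j$ having the same label sequence $L_i,\dots,L_j$, their reset sets coincide position-wise: $Z_k=Z'_k$ for all $k\in[i..j]$. *)

theory Defs
  imports Complex_Main
begin

text \<open>Events have an abstract type 'e; basic predicates are names of type 'b,
  interpreted by a fixed function bsem :: 'b \<Rightarrow> 'e set.  The predicate set P
  is the closure of the basic predicates under intersection and complement,
  together with E (the set of all events).\<close>

datatype 'b pred = PBasic 'b | PAll | PInter "'b pred" "'b pred" | PCompl "'b pred"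

fun psem :: "('b \<Rightarrow> 'e set) \<Rightarrow> 'b pred \<Rightarrow> 'e set" where
  "psem bs (PBasic b) = bs b"
| "psem bs PAll = UNIV"
| "psem bs (PInter p1 p2) = psem bs p1 \<inter> psem bs p2"
| "psem bs (PCompl p) = UNIV - psem bs p"

fun psize :: "'b pred \<Rightarrow> nat" where
  "psize (PBasic b) = 1"
| "psize PAll = 1"
| "psize (PInter p1 p2) = psize p1 + psize p2"
| "psize (PCompl p) = psize p + 1"

datatype cmp = CEq | CLt | CLe | CGe | CGt

datatype 'z ccond = CTrue | CCmp 'z cmp rat | CAnd "'z ccond" "'z ccond" | COr "'z ccond" "'z ccond"

fun csize :: "'z ccond \<Rightarrow> nat" where
  "csize CTrue = 0"
| "csize (CCmp z r c) = 1"
| "csize (CAnd g1 g2) = csize g1 + csize g2 + 1"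
| "csize (COr g1 g2) = csize g1 + csize g2 + 1"

fun cclocks :: "'z ccond \<Rightarrow> 'z set" where
  "cclocks CTrue = {}"
| "cclocks (CCmp z r c) = {z}"
| "cclocks (CAnd g1 g2) = cclocks g1 \<union> cclocks g2"
| "cclocks (COr g1 g2) = cclocks g1 \<union> cclocks g2"

fun cconsts :: "'z ccond \<Rightarrow> rat set" where
  "cconsts CTrue = {}"
| "cconsts (CCmp z r c) = {c}"
| "cconsts (CAnd g1 g2) = cconsts g1 \<union> cconsts g2"
| "cconsts (COr g1 g2) = cconsts g1 \<union> cconsts g2"

fun cmp_eval :: "cmp \<Rightarrow> real \<Rightarrow> real \<Rightarrow> bool" where
  "cmp_eval CEq x y = (x = y)"
| "cmp_eval CLt x y = (x < y)"
| "cmp_eval CLe x y = (x \<le> y)"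
| "cmp_eval CGe x y = (x \<ge> y)"
| "cmp_eval CGt x y = (x > y)"

type_synonym 'z valuation = "'z \<Rightarrow> real option"

fun ceval :: "'z valuation \<Rightarrow> 'z ccond \<Rightarrow> bool" where
  "ceval \<nu> CTrue = True"
| "ceval \<nu> (CCmp z r c) = cmp_eval r (the (\<nu> z)) (real_of_rat c)"
| "ceval \<nu> (CAnd g1 g2) = (ceval \<nu> g1 \<and> ceval \<nu> g2)"
| "ceval \<nu> (COr g1 g2) = (ceval \<nu> g1 \<or> ceval \<nu> g2)"

definition csat :: "'z valuation \<Rightarrow> 'z ccond \<Rightarrow> bool" where
  "csat \<nu> g \<longleftrightarrow> cclocks g \<subseteq> dom \<nu> \<and> ceval \<nu> g"

definition vplus :: "'z valuation \<Rightarrow> real \<Rightarrow> 'z valuation" where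
  "vplus \<nu> t = (\<lambda>z. map_option (\<lambda>v. v + t) (\<nu> z))"

definition vreset :: "'z set \<Rightarrow> 'z valuation \<Rightarrow> 'z valuation" where
  "vreset Z \<nu> = (\<lambda>z. if z \<in> Z then Some 0 else \<nu> z)"

type_synonym ('q, 'b, 'x, 'z) trans = "'q \<times> 'b pred \<times> 'z ccond \<times> 'x set \<times> 'z set \<times> 'q"

definition tsrc :: "('q, 'b, 'x, 'z) trans \<Rightarrow> 'q" where "tsrc t = fst t"
definition tpred :: "('q, 'b, 'x, 'z) trans \<Rightarrow> 'b pred" where "tpred t = fst (snd t)"
definition tguard :: "('q, 'b, 'x, 'z) trans \<Rightarrow> 'z ccond" where "tguard t = fst (snd (snd t))"
definition tlab :: "('q, 'b, 'x, 'z) trans \<Rightarrow> 'x set" where "tlab t = fst (snd (snd (snd t)))"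
definition treset :: "('q, 'b, 'x, 'z) trans \<Rightarrow> 'z set" where "treset t = fst (snd (snd (snd (snd t))))"
definition ttgt :: "('q, 'b, 'x, 'z) trans \<Rightarrow> 'q" where "ttgt t = snd (snd (snd (snd (snd t))))"

record ('q, 'b, 'x, 'z) tcea =
  states :: "'q set"
  vars :: "'x set"
  clocks :: "'z set"
  delta :: "('q, 'b, 'x, 'z) trans set"
  init :: "'q"
  final :: "'q set"

definition wf_tcea :: "('q, 'b, 'x, 'z) tcea \<Rightarrow> bool" where
  "wf_tcea T \<longleftrightarrow>
     finite (states T) \<and> finite (vars T) \<and> finite (clocks T) \<and> finite (delta T) \<and>
     init T \<in> states T \<and> final T \<subseteq> states T \<and>
     (\<forall>t\<in>delta T. tsrc t \<in> states T \<and> ttgt t \<in> states T \<and>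
        cclocks (tguard t) \<subseteq> clocks T \<and> (\<forall>c\<in>cconsts (tguard t). c \<ge> 0) \<and>
        tlab t \<subseteq> vars T \<and> treset t \<subseteq> clocks T)"

definition tcea_size :: "('q, 'b, 'x, 'z) tcea \<Rightarrow> nat" where
  "tcea_size T = card (states T) +
     (\<Sum>t\<in>delta T. csize (tguard t) + psize (tpred t) + card (tlab t) + card (treset t))"

text \<open>A timed stream (e_1,t_1)...(e_n,t_n); positions are 1-based.\<close>
type_synonym 'e tstream = "('e \<times> rat) list"

definition valid_stream :: "'e tstream \<Rightarrow> bool" where
  "valid_stream S \<longleftrightarrow> (\<forall>k < length S. snd (S ! k) \<ge> 0) \<and>
     (\<forall>k. Suc k < length S \<longrightarrow> snd (S ! k) < snd (S ! Suc k))"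

definition ev :: "'e tstream \<Rightarrow> nat \<Rightarrow> 'e" where "ev S k = fst (S ! (k - 1))"
definition tm :: "'e tstream \<Rightarrow> nat \<Rightarrow> rat" where "tm S k = snd (S ! (k - 1))"
definition dt :: "'e tstream \<Rightarrow> nat \<Rightarrow> real" where
  "dt S k = (if k = 1 then real_of_rat (tm S 1) else real_of_rat (tm S k - tm S (k - 1)))"

text \<open>A run from position i to j: states qs k, valuations vs k and transitions ts k
  for k in [i..j] (with qs (j+1), vs (j+1) the final configuration).\<close>
definition is_run :: "('b \<Rightarrow> 'e set) \<Rightarrow> ('q, 'b, 'x, 'z) tcea \<Rightarrow> 'e tstream \<Rightarrow> nat \<Rightarrow> nat \<Rightarrow>
    (nat \<Rightarrow> 'q) \<Rightarrow> (nat \<Rightarrow> 'z valuation) \<Rightarrow> (nat \<Rightarrow> ('q, 'b, 'x, 'z) trans) \<Rightarrow> bool" where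
  "is_run bs T S i j qs vs ts \<longleftrightarrow>
     1 \<le> i \<and> i \<le> j \<and> j \<le> length S \<and>
     qs i = init T \<and> vs i = (\<lambda>_. None) \<and>
     (\<forall>k\<in>{i..j}. ts k \<in> delta T \<and> tsrc (ts k) = qs k \<and> ttgt (ts k) = qs (Suc k) \<and>
        ev S k \<in> psem bs (tpred (ts k)) \<and>
        csat (vplus (vs k) (dt S k)) (tguard (ts k)) \<and>
        vs (Suc k) = vreset (treset (ts k)) (vplus (vs k) (dt S k)))"

definition sem :: "('b \<Rightarrow> 'e set) \<Rightarrow> ('q, 'b, 'x, 'z) tcea \<Rightarrow> 'e tstream \<Rightarrow> (nat \<times> nat \<times> ('x \<Rightarrow> nat set)) set" where
  "sem bs T S = {(i, j, \<mu>) | i j \<mu>. \<exists>qs vs ts. is_run bs T S i j qs vs ts \<and> qs (Suc j) \<in> final T \<and>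
      \<mu> = (\<lambda>X. {k \<in> {i..j}. X \<in> tlab (ts k)})}"

definition csatisfiable :: "'z ccond \<Rightarrow> bool" where
  "csatisfiable g \<longleftrightarrow> (\<exists>\<nu>. csat \<nu> g)"

definition deterministic :: "('b \<Rightarrow> 'e set) \<Rightarrow> ('q, 'b, 'x, 'z) tcea \<Rightarrow> bool" where
  "deterministic bs T \<longleftrightarrow>
     (\<forall>t1\<in>delta T. \<forall>t2\<in>delta T.
        t1 \<noteq> t2 \<and> tsrc t1 = tsrc t2 \<and> psem bs (tpred t1) \<inter> psem bs (tpred t2) \<noteq> {} \<and>
        csatisfiable (CAnd (tguard t1) (tguard t2)) \<longrightarrow> tlab t1 \<noteq> tlab t2)"

definition sync_resets :: "('b \<Rightarrow> 'e set) \<Rightarrow> ('q, 'b, 'x, 'z) tcea \<Rightarrow> bool" where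
  "sync_resets bs T \<longleftrightarrow>
     (\<forall>(S :: 'e tstream) i j qs vs ts qs' vs' ts'. valid_stream S \<and>
        is_run bs T S i j qs vs ts \<and> is_run bs T S i j qs' vs' ts' \<and>
        (\<forall>k\<in>{i..j}. tlab (ts k) = tlab (ts' k)) \<longrightarrow>
        (\<forall>k\<in>{i..j}. treset (ts k) = treset (ts' k)))"

end

theory Submission
  imports Defs
begin

text \<open>
  Synchronous resets force all runs with the same label sequence to carry the same clock
  valuation, so a subset construction works with states \<open>(R, V)\<close>: the set \<open>R\<close> of reachable states
  and the set \<open>V\<close> of defined clocks. The latter is needed because clock conditions cannot test that
  a clock is undefined.

  Tracking \<open>V\<close> costs a factor \<open>2 ^ K\<close>, where \<open>K\<close> is the number of distinct reset sets, and
  enumerating all outcomes (predicate fails, only the guard fails, enabled) of all \<open>N\<close> transitions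
  would then break the size bound. Instead the outcomes are explored as a decision tree: as soon as
  one transition with reset set \<open>Z\<close> is found to be enabled, synchrony implies that later transitions
  with another reset set are disabled, so they are skipped. If \<open>c\<close> later transitions share
  the reset set \<open>Z\<close>, they contribute \<open>3 ^ c\<close> outcomes, but \<open>K \<le> N - c\<close>; this compensation
  bounds the total number of transitions by \<open>2 ^ |Q| * 2 * 4 ^ N\<close>.
\<close>

section \<open>Negated clock conditions\<close>

text \<open>Clock conditions lack negation, so it is pushed down to the atoms, where an equality
  splits into two strict comparisons. False is written as a contradiction about the clock
  \<open>z0\<close>; its constant 0 keeps constants nonnegative.\<close>

fun neg_cond :: "'z \<Rightarrow> 'z ccond \<Rightarrow> 'z ccond" where
  "neg_cond z0 CTrue = CAnd (CCmp z0 CLt 0) (CCmp z0 CGt 0)"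
| "neg_cond z0 (CCmp z CEq c) = COr (CCmp z CLt c) (CCmp z CGt c)"
| "neg_cond z0 (CCmp z CLt c) = CCmp z CGe c"
| "neg_cond z0 (CCmp z CLe c) = CCmp z CGt c"
| "neg_cond z0 (CCmp z CGe c) = CCmp z CLt c"
| "neg_cond z0 (CCmp z CGt c) = CCmp z CLe c"
| "neg_cond z0 (CAnd g1 g2) = COr (neg_cond z0 g1) (neg_cond z0 g2)"
| "neg_cond z0 (COr g1 g2) = CAnd (neg_cond z0 g1) (neg_cond z0 g2)"

text \<open>The constant false is expressed with a clock of the condition itself, so that negation
  requires no further clock to be defined. Without such a clock the condition is always true, and
  then the arbitrary element selected from the empty set is harmless.\<close>

definition negc :: "'z ccond \<Rightarrow> 'z ccond" where
  "negc g = neg_cond (SOME z. z \<in> cclocks g) g"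

lemma ceval_neg_cond [simp]: "ceval \<nu> (neg_cond z0 g) \<longleftrightarrow> \<not> ceval \<nu> g"
  by (induction z0 g rule: neg_cond.induct) auto

lemma cclocks_neg_cond_subset: "cclocks (neg_cond z0 g) \<subseteq> insert z0 (cclocks g)"
  by (induction z0 g rule: neg_cond.induct) auto

lemma cclocks_subset_neg_cond: "cclocks g \<subseteq> cclocks (neg_cond z0 g)"
  by (induction z0 g rule: neg_cond.induct) auto

text \<open>Without clocks only \<open>CTrue\<close>, conjunction and disjunction remain, and these
  cannot express false.\<close>

lemma ceval_no_clocks: "cclocks g = {} \<Longrightarrow> ceval \<nu> g"
  by (induction g) auto

text \<open>If some clock of \<open>g\<close> is undefined, neither \<open>g\<close> nor
  \<open>negc g\<close> is satisfied. If \<open>g\<close> has no clocks, \<open>negc g\<close> may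
  mention a foreign clock, but then \<open>g\<close> is always true and both sides are
  false.\<close>

lemma csat_negc: "csat \<nu> (negc g) \<longleftrightarrow> cclocks g \<subseteq> dom \<nu> \<and> \<not> ceval \<nu> g"
proof (cases "cclocks g = {}")
  case True
  then show ?thesis by (simp add: csat_def negc_def ceval_no_clocks)
next
  case False
  then have "(SOME z. z \<in> cclocks g) \<in> cclocks g"
    by (simp add: some_in_eq)
  then have "cclocks (negc g) = cclocks g"
    unfolding negc_def using cclocks_neg_cond_subset cclocks_subset_neg_cond by fast
  then show ?thesis by (simp add: csat_def negc_def)
qed

lemma cclocks_negc_subset: "cclocks (negc g) \<subseteq> insert (SOME z. z \<in> {}) (cclocks g)"
proof (cases "cclocks g = {}")
  case True
  then show ?thesis using cclocks_neg_cond_subset[of _ g] by (simp add: negc_def)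
next
  case False
  then have "(SOME z. z \<in> cclocks g) \<in> cclocks g"
    by (simp add: some_in_eq)
  then show ?thesis
    unfolding negc_def using cclocks_neg_cond_subset by fast
qed

lemma cconsts_neg_cond: "cconsts (neg_cond z0 g) \<subseteq> insert 0 (cconsts g)"
  by (induction z0 g rule: neg_cond.induct) auto

lemma cconsts_negc: "cconsts (negc g) \<subseteq> insert 0 (cconsts g)"
  unfolding negc_def by (rule cconsts_neg_cond)

text \<open>The offset 3 is the size of the contradiction for \<open>CTrue\<close>. At a binary
  connective, two offsets and the connective itself give 7 = 4 + 3, so the factor 4 closes the
  induction.\<close>

lemma csize_neg_cond: "csize (neg_cond z0 g) \<le> 4 * csize g + 3"
  by (induction z0 g rule: neg_cond.induct) auto

lemma csize_negc: "csize (negc g) \<le> 4 * csize g + 3"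
  unfolding negc_def by (rule csize_neg_cond)

section \<open>Renaming clocks\<close>

lemma cclocks_map_ccond [simp]: "cclocks (map_ccond h g) = h ` cclocks g"
  by (induction g) auto

lemma cconsts_map_ccond [simp]: "cconsts (map_ccond h g) = cconsts g"
  by (induction g) auto

lemma csize_map_ccond [simp]: "csize (map_ccond h g) = csize g"
  by (induction g) auto

lemma ceval_map_ccond: "ceval \<nu> (map_ccond h g) \<longleftrightarrow> ceval (\<nu> \<circ> h) g"
  by (induction g) auto

lemma csat_map_ccond: "csat \<nu> (map_ccond h g) \<longleftrightarrow> csat (\<nu> \<circ> h) g"
  unfolding csat_def ceval_map_ccond by auto

lemma ceval_cong: "(\<And>z. z \<in> cclocks g \<Longrightarrow> \<nu> z = \<nu>' z) \<Longrightarrow> ceval \<nu> g \<longleftrightarrow> ceval \<nu>' g"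
  by (induction g) auto

lemma csat_cong: "(\<And>z. z \<in> cclocks g \<Longrightarrow> \<nu> z = \<nu>' z) \<Longrightarrow> csat \<nu> g \<longleftrightarrow> csat \<nu>' g"
  using ceval_cong[of g \<nu> \<nu>'] unfolding csat_def by (auto simp: domIff subset_iff)

lemma dom_vplus [simp]: "dom (vplus \<nu> t) = dom \<nu>"
  by (auto simp: vplus_def dom_def)

lemma dom_vreset [simp]: "dom (vreset Z \<nu>) = dom \<nu> \<union> Z"
  by (auto simp: vreset_def dom_def)

section \<open>The decision tree of enabled transitions\<close>

text \<open>A branch consists of a predicate, a clock condition and the set of transitions that are enabled
  if both hold.\<close>

type_synonym ('q, 'b, 'x, 'z) branch = "'b pred \<times> 'z ccond \<times> ('q, 'b, 'x, 'z) trans set"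

fun fail_pred :: "('q, 'b, 'x, 'z) trans \<Rightarrow> ('q, 'b, 'x, 'z) branch \<Rightarrow> ('q, 'b, 'x, 'z) branch" where
  "fail_pred t (p, g, D) = (PInter (PCompl (tpred t)) p, g, D)"

text \<open>Keeping \<open>tpred t\<close> positive separates this case from
  \<open>fail_pred\<close>, so the three cases for \<open>t\<close> exclude each other.\<close>

fun fail_guard :: "('q, 'b, 'x, 'z) trans \<Rightarrow> ('q, 'b, 'x, 'z) branch \<Rightarrow> ('q, 'b, 'x, 'z) branch" where
  "fail_guard t (p, g, D) = (PInter (tpred t) p, CAnd (negc (tguard t)) g, D)"

fun enable :: "('q, 'b, 'x, 'z) trans \<Rightarrow> ('q, 'b, 'x, 'z) branch \<Rightarrow> ('q, 'b, 'x, 'z) branch" where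
  "enable t (p, g, D) = (PInter (tpred t) p, CAnd (tguard t) g, insert t D)"

text \<open>Only transitions satisfying \<open>act\<close> are examined. Phase two starts after the first enabled
  transition, whose reset set is \<open>Z\<close>.\<close>

fun branches2 :: "(('q, 'b, 'x, 'z) trans \<Rightarrow> bool) \<Rightarrow> 'z set \<Rightarrow> ('q, 'b, 'x, 'z) trans list
    \<Rightarrow> ('q, 'b, 'x, 'z) branch set" where
  "branches2 act Z [] = {(PAll, CTrue, {})}"
| "branches2 act Z (t # ts) =
     (let B = branches2 act Z ts in
      if act t \<and> treset t = Z then fail_pred t ` B \<union> fail_guard t ` B \<union> enable t ` B else B)"

text \<open>The empty base case drops the outcome in which nothing is enabled, so each branch
  carries at least one transition. \<open>branches2\<close> keeps the corresponding leaf, since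
  there an enabled transition has already been chosen.\<close>

fun branches1 :: "(('q, 'b, 'x, 'z) trans \<Rightarrow> bool) \<Rightarrow> ('q, 'b, 'x, 'z) trans list
    \<Rightarrow> ('q, 'b, 'x, 'z) branch set" where
  "branches1 act [] = {}"
| "branches1 act (t # ts) =
     (let B = branches1 act ts in
      if act t then fail_pred t ` B \<union> fail_guard t ` B \<union> enable t ` branches2 act (treset t) ts
      else B)"

definition holds :: "('b \<Rightarrow> 'e set) \<Rightarrow> 'e \<Rightarrow> 'z valuation \<Rightarrow> ('q, 'b, 'x, 'z) branch \<Rightarrow> bool" where
  "holds bs e \<nu> b \<longleftrightarrow> e \<in> psem bs (fst b) \<and> csat \<nu> (fst (snd b))"

definition enabled :: "('b \<Rightarrow> 'e set) \<Rightarrow> 'e \<Rightarrow> 'z valuation \<Rightarrow> ('q, 'b, 'x, 'z) trans \<Rightarrow> bool" where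
  "enabled bs e \<nu> t \<longleftrightarrow> e \<in> psem bs (tpred t) \<and> csat \<nu> (tguard t)"

section \<open>Uniqueness, soundness and completeness of branches\<close>

lemma csat_CAnd [simp]: "csat \<nu> (CAnd g1 g2) \<longleftrightarrow> csat \<nu> g1 \<and> csat \<nu> g2"
  by (auto simp: csat_def)

lemma csat_CTrue [simp]: "csat \<nu> CTrue"
  by (simp add: csat_def)

lemma holds_leaf [simp]: "holds bs e \<nu> (PAll, CTrue, D)"
  by (simp add: holds_def)

lemma holds_fail_pred [simp]:
  "holds bs e \<nu> (fail_pred t b) \<longleftrightarrow> e \<notin> psem bs (tpred t) \<and> holds bs e \<nu> b"
  by (cases b) (auto simp: holds_def)

lemma holds_fail_guard [simp]:
  "holds bs e \<nu> (fail_guard t b) \<longleftrightarrow>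
     e \<in> psem bs (tpred t) \<and> csat \<nu> (negc (tguard t)) \<and> holds bs e \<nu> b"
  by (cases b) (auto simp: holds_def)

lemma holds_enable [simp]:
  "holds bs e \<nu> (enable t b) \<longleftrightarrow> enabled bs e \<nu> t \<and> holds bs e \<nu> b"
  by (cases b) (auto simp: holds_def enabled_def)

lemma snd_snd_fail_pred [simp]: "snd (snd (fail_pred t b)) = snd (snd b)"
  by (cases b) simp

lemma snd_snd_fail_guard [simp]: "snd (snd (fail_guard t b)) = snd (snd b)"
  by (cases b) simp

lemma snd_snd_enable [simp]: "snd (snd (enable t b)) = insert t (snd (snd b))"
  by (cases b) simp

lemma fst_snd_fail_pred [simp]: "fst (snd (fail_pred t b)) = fst (snd b)"
  by (cases b) simp

lemma fst_snd_fail_guard [simp]: "fst (snd (fail_guard t b)) = CAnd (negc (tguard t)) (fst (snd b))"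
  by (cases b) simp

lemma fst_snd_enable [simp]: "fst (snd (enable t b)) = CAnd (tguard t) (fst (snd b))"
  by (cases b) simp

lemma not_csat_and_negc: "csat \<nu> g \<Longrightarrow> \<not> csat \<nu> (negc g)"
  unfolding csat_negc by (simp add: csat_def)

lemma branches2_ConsE:
  assumes "b \<in> branches2 act Z (t # ts)"
  obtains
    (fail_pred) b' where "act t" "treset t = Z" "b' \<in> branches2 act Z ts" "b = fail_pred t b'"
  | (fail_guard) b' where "act t" "treset t = Z" "b' \<in> branches2 act Z ts" "b = fail_guard t b'"
  | (enable) b' where "act t" "treset t = Z" "b' \<in> branches2 act Z ts" "b = enable t b'"
  | (skip) "\<not> (act t \<and> treset t = Z)" "b \<in> branches2 act Z ts"
  using assms by (auto simp: Let_def split: if_splits)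

lemma branches1_ConsE:
  assumes "b \<in> branches1 act (t # ts)"
  obtains
    (fail_pred) b' where "act t" "b' \<in> branches1 act ts" "b = fail_pred t b'"
  | (fail_guard) b' where "act t" "b' \<in> branches1 act ts" "b = fail_guard t b'"
  | (enable) b' where "act t" "b' \<in> branches2 act (treset t) ts" "b = enable t b'"
  | (skip) "\<not> act t" "b \<in> branches1 act ts"
  using assms by (auto simp: Let_def split: if_splits)

text \<open>The three cases for an examined transition exclude each other, so an event and a
  valuation follow at most one path through the tree.\<close>

lemma branches2_unique:
  "b \<in> branches2 act Z ts \<Longrightarrow> b' \<in> branches2 act Z ts \<Longrightarrow> holds bs e \<nu> b \<Longrightarrow> holds bs e \<nu> b' \<Longrightarrow> b = b'"
proof (induction ts arbitrary: b b')
  case (Cons t ts)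
  show ?case
    by (rule branches2_ConsE[OF Cons.prems(1)]; rule branches2_ConsE[OF Cons.prems(2)];
        insert Cons.prems(3,4); simp add: enabled_def not_csat_and_negc; metis Cons.IH)
qed simp

lemma branches1_unique:
  "b \<in> branches1 act ts \<Longrightarrow> b' \<in> branches1 act ts \<Longrightarrow> holds bs e \<nu> b \<Longrightarrow> holds bs e \<nu> b' \<Longrightarrow> b = b'"
proof (induction ts arbitrary: b b')
  case (Cons t ts)
  show ?case
    by (rule branches1_ConsE[OF Cons.prems(1)]; rule branches1_ConsE[OF Cons.prems(2)];
        insert Cons.prems(3,4); simp add: enabled_def not_csat_and_negc;
        metis Cons.IH branches2_unique)
qed simp

lemma not_enabled_fail_pred: "e \<notin> psem bs (tpred t) \<Longrightarrow> \<not> enabled bs e \<nu> t"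
  by (simp add: enabled_def)

lemma not_enabled_fail_guard: "csat \<nu> (negc (tguard t)) \<Longrightarrow> \<not> enabled bs e \<nu> t"
  using not_csat_and_negc by (auto simp: enabled_def)

lemma branches2_sound:
  assumes "b \<in> branches2 act Z ts" and "holds bs e \<nu> b"
  shows "snd (snd b) = {t \<in> set ts. act t \<and> treset t = Z \<and> enabled bs e \<nu> t}"
  using assms
proof (induction ts arbitrary: b)
  case (Cons t ts)
  from Cons.prems(1) show ?case
  proof (cases rule: branches2_ConsE)
    case (fail_pred b')
    with Cons.prems(2) Cons.IH[of b'] show ?thesis by (auto dest: not_enabled_fail_pred)
  next
    case (fail_guard b')
    with Cons.prems(2) Cons.IH[of b'] show ?thesis by (auto dest: not_enabled_fail_guard)
  next
    case (enable b')
    with Cons.prems(2) Cons.IH[of b'] show ?thesis by auto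
  next
    case skip
    with Cons.prems(2) Cons.IH[of b] show ?thesis by auto
  qed
qed simp

text \<open>After the first enabled transition only its reset set is examined further; the
  assumption on equal resets ensures that no enabled active transition is overlooked
  thereby.\<close>

lemma branches1_sound:
  assumes "b \<in> branches1 act ts" and "holds bs e \<nu> b"
    and "\<And>t t'. \<lbrakk>t \<in> set ts; t' \<in> set ts; act t; act t'; enabled bs e \<nu> t; enabled bs e \<nu> t'\<rbrakk>
      \<Longrightarrow> treset t = treset t'"
  shows "snd (snd b) = {t \<in> set ts. act t \<and> enabled bs e \<nu> t}"
  using assms
proof (induction ts arbitrary: b)
  case (Cons t ts)
  have IH: "snd (snd b') = {t \<in> set ts. act t \<and> enabled bs e \<nu> t}"
    if "b' \<in> branches1 act ts" "holds bs e \<nu> b'" for b'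
    using that by (rule Cons.IH) (rule Cons.prems(3), auto)
  from Cons.prems(1) show ?case
  proof (cases rule: branches1_ConsE)
    case (fail_pred b')
    with Cons.prems(2) IH[of b'] show ?thesis by (auto dest: not_enabled_fail_pred)
  next
    case (fail_guard b')
    with Cons.prems(2) IH[of b'] show ?thesis by (auto dest: not_enabled_fail_guard)
  next
    case (enable b')
    then have en: "enabled bs e \<nu> t" and b': "holds bs e \<nu> b'"
      using Cons.prems(2) by auto
    have "treset t' = treset t" if "t' \<in> set ts" "act t'" "enabled bs e \<nu> t'" for t'
      using Cons.prems(3)[of t' t] that enable(1) en by simp
    then show ?thesis
      using branches2_sound[OF enable(2) b'] enable(1,3) en by auto
  next
    case skip
    with Cons.prems(2) IH[of b] show ?thesis by auto
  qed
qed simp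

lemma negated_guard_holds:
  "\<lbrakk>cclocks (tguard t) \<subseteq> dom \<nu>; e \<in> psem bs (tpred t); \<not> enabled bs e \<nu> t\<rbrakk> \<Longrightarrow> csat \<nu> (negc (tguard t))"
  unfolding csat_negc by (auto simp: enabled_def csat_def)

lemma branches2_complete:
  assumes "\<And>t. t \<in> set ts \<Longrightarrow> act t \<Longrightarrow> cclocks (tguard t) \<subseteq> dom \<nu>"
  shows "\<exists>b\<in>branches2 act Z ts. holds bs e \<nu> b"
  using assms
proof (induction ts)
  case (Cons t ts)
  then obtain b where b: "b \<in> branches2 act Z ts" "holds bs e \<nu> b" by auto
  show ?case
  proof (cases "act t \<and> treset t = Z")
    case True
    then have cl: "cclocks (tguard t) \<subseteq> dom \<nu>" using Cons.prems by simp
    have "holds bs e \<nu> (fail_pred t b) \<or> holds bs e \<nu> (fail_guard t b) \<or> holds bs e \<nu> (enable t b)"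
      using b(2) negated_guard_holds[OF cl, of e bs] by auto
    then show ?thesis using b(1) True by (auto simp: Let_def simp del: holds_fail_pred holds_fail_guard holds_enable)
  next
    case False
    with b show ?thesis by (auto simp: Let_def)
  qed
qed simp

text \<open>Definedness of the guard clocks makes the three cases exhaustive, as then a guard or its
  \<open>negc\<close> holds. An enabled transition is assumed because \<open>branches1\<close> has
  no branch in which all of them fail.\<close>

lemma branches1_complete:
  assumes "\<And>t. t \<in> set ts \<Longrightarrow> act t \<Longrightarrow> cclocks (tguard t) \<subseteq> dom \<nu>"
    and "\<exists>t\<in>set ts. act t \<and> enabled bs e \<nu> t"
  shows "\<exists>b\<in>branches1 act ts. holds bs e \<nu> b"
  using assms
proof (induction ts)
  case (Cons t ts)
  show ?case
  proof (cases "act t \<and> enabled bs e \<nu> t")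
    case True
    obtain b where "b \<in> branches2 act (treset t) ts" "holds bs e \<nu> b"
      using branches2_complete[of ts act \<nu> "treset t" bs e] Cons.prems(1) by auto
    then have "enable t b \<in> branches1 act (t # ts)" "holds bs e \<nu> (enable t b)"
      using True by (auto simp: Let_def)
    then show ?thesis by blast
  next
    case False
    then have "\<exists>t\<in>set ts. act t \<and> enabled bs e \<nu> t"
      using Cons.prems(2) by auto
    then obtain b where b: "b \<in> branches1 act ts" "holds bs e \<nu> b"
      using Cons.IH Cons.prems(1) by (meson list.set_intros(2))
    show ?thesis
    proof (cases "act t")
      case True
      then have cl: "cclocks (tguard t) \<subseteq> dom \<nu>" using Cons.prems by simp
      have "holds bs e \<nu> (fail_pred t b) \<or> holds bs e \<nu> (fail_guard t b)"
        using b(2) negated_guard_holds[OF cl, of e bs] False True by auto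
      then show ?thesis using b(1) True by (auto simp: Let_def simp del: holds_fail_pred holds_fail_guard)
    next
      case False
      with b show ?thesis by (auto simp: Let_def)
    qed
  qed
qed simp

section \<open>Transitions, clocks and constants occurring in branches\<close>

lemma branches2_transitions:
  "b \<in> branches2 act Z ts \<Longrightarrow> t \<in> snd (snd b) \<Longrightarrow> t \<in> set ts \<and> act t \<and> treset t = Z"
proof (induction ts arbitrary: b)
  case (Cons t' ts)
  from Cons.prems(1) show ?case
    by (cases rule: branches2_ConsE; use Cons.prems(2) Cons.IH in fastforce)
qed simp

text \<open>This allows a branch to become a single transition of the subset automaton: its reset
  set is well defined and is that of an original transition.\<close>

lemma branches1_transitions:
  assumes "b \<in> branches1 act ts"
  shows "\<exists>t\<in>snd (snd b). \<forall>t'\<in>snd (snd b). t' \<in> set ts \<and> act t' \<and> treset t' = treset t"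
  using assms
proof (induction ts arbitrary: b)
  case (Cons t ts)
  from Cons.prems show ?case
  proof (cases rule: branches1_ConsE)
    case (fail_pred b')
    then show ?thesis using Cons.IH[of b'] by simp blast
  next
    case (fail_guard b')
    then show ?thesis using Cons.IH[of b'] by simp blast
  next
    case (enable b')
    then show ?thesis using branches2_transitions[of b' act "treset t" ts] by simp
  next
    case skip
    then show ?thesis using Cons.IH[of b] by simp blast
  qed
qed simp

text \<open>The additional clock is the one that \<open>negc\<close> picks for guards without
  clocks.\<close>

lemma branches2_clocks:
  assumes "b \<in> branches2 act Z ts" and "\<And>t. t \<in> set ts \<Longrightarrow> cclocks (tguard t) \<subseteq> C"
  shows "cclocks (fst (snd b)) \<subseteq> insert (SOME z. z \<in> {}) C"
  using assms
proof (induction ts arbitrary: b)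
  case (Cons t ts)
  have "cclocks (negc (tguard t)) \<subseteq> insert (SOME z. z \<in> {}) C"
    using cclocks_negc_subset[of "tguard t"] Cons.prems(2)[of t] by auto
  moreover have "cclocks (tguard t) \<subseteq> insert (SOME z. z \<in> {}) C" using Cons.prems(2)[of t] by auto
  moreover have IH: "cclocks (fst (snd b')) \<subseteq> insert (SOME z. z \<in> {}) C"
    if "b' \<in> branches2 act Z ts" for b'
    using Cons.IH[OF that] Cons.prems(2) by simp
  ultimately show ?case
    by (cases rule: branches2_ConsE[OF Cons.prems(1)]) (simp_all add: IH)
qed simp

lemma branches1_clocks:
  assumes "b \<in> branches1 act ts" and "\<And>t. t \<in> set ts \<Longrightarrow> cclocks (tguard t) \<subseteq> C"
  shows "cclocks (fst (snd b)) \<subseteq> insert (SOME z. z \<in> {}) C"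
  using assms
proof (induction ts arbitrary: b)
  case (Cons t ts)
  have "cclocks (negc (tguard t)) \<subseteq> insert (SOME z. z \<in> {}) C"
    using cclocks_negc_subset[of "tguard t"] Cons.prems(2)[of t] by auto
  moreover have "cclocks (tguard t) \<subseteq> insert (SOME z. z \<in> {}) C" using Cons.prems(2)[of t] by auto
  moreover have IH: "cclocks (fst (snd b')) \<subseteq> insert (SOME z. z \<in> {}) C"
    if "b' \<in> branches1 act ts" for b'
    using Cons.IH[OF that] Cons.prems(2) by simp
  moreover have b2: "cclocks (fst (snd b')) \<subseteq> insert (SOME z. z \<in> {}) C"
    if "b' \<in> branches2 act (treset t) ts" for b'
    using branches2_clocks[OF that] Cons.prems(2) by simp
  ultimately show ?case
    by (cases rule: branches1_ConsE[OF Cons.prems(1)]) (simp_all add: IH b2)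
qed simp

lemma branches2_consts:
  assumes "b \<in> branches2 act Z ts" and "\<And>t. t \<in> set ts \<Longrightarrow> \<forall>c\<in>cconsts (tguard t). c \<ge> 0"
  shows "\<forall>c\<in>cconsts (fst (snd b)). c \<ge> 0"
  using assms
proof (induction ts arbitrary: b)
  case (Cons t ts)
  have "\<forall>c\<in>cconsts (negc (tguard t)). c \<ge> 0"
    using cconsts_negc[of "tguard t"] Cons.prems(2)[of t] by auto
  moreover have "\<forall>c\<in>cconsts (tguard t). c \<ge> 0" using Cons.prems(2)[of t] by simp
  moreover have IH: "\<forall>c\<in>cconsts (fst (snd b')). c \<ge> 0"
    if "b' \<in> branches2 act Z ts" for b'
    using Cons.IH[OF that] Cons.prems(2) by (meson list.set_intros(2))
  ultimately show ?case
    by (cases rule: branches2_ConsE[OF Cons.prems(1)]) (simp_all add: ball_Un IH)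
qed simp

lemma branches1_consts:
  assumes "b \<in> branches1 act ts" and "\<And>t. t \<in> set ts \<Longrightarrow> \<forall>c\<in>cconsts (tguard t). c \<ge> 0"
  shows "\<forall>c\<in>cconsts (fst (snd b)). c \<ge> 0"
  using assms
proof (induction ts arbitrary: b)
  case (Cons t ts)
  have "\<forall>c\<in>cconsts (negc (tguard t)). c \<ge> 0"
    using cconsts_negc[of "tguard t"] Cons.prems(2)[of t] by auto
  moreover have "\<forall>c\<in>cconsts (tguard t). c \<ge> 0" using Cons.prems(2)[of t] by simp
  moreover have IH: "\<forall>c\<in>cconsts (fst (snd b')). c \<ge> 0"
    if "b' \<in> branches1 act ts" for b'
    using Cons.IH[OF that] Cons.prems(2) by (meson list.set_intros(2))
  moreover have b2: "\<forall>c\<in>cconsts (fst (snd b')). c \<ge> 0"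
    if "b' \<in> branches2 act (treset t) ts" for b'
    using branches2_consts[OF that] Cons.prems(2) by (meson list.set_intros(2))
  ultimately show ?case
    by (cases rule: branches1_ConsE[OF Cons.prems(1)]) (simp_all add: ball_Un IH b2)
qed simp

section \<open>Size of the decision tree\<close>

definition branch_size :: "('q, 'b, 'x, 'z) branch \<Rightarrow> nat" where
  "branch_size b = psize (fst b) + csize (fst (snd b))"

abbreviation cond_size :: "('q, 'b, 'x, 'z) trans \<Rightarrow> nat" where
  "cond_size t \<equiv> psize (tpred t) + csize (tguard t)"

lemma psize_ge_1: "psize p \<ge> 1"
  by (induction p) auto

text \<open>The worst case is \<open>fail_guard\<close>: the negated guard costs at most
  \<open>4 * csize (tguard t) + 3\<close> and the conjunction 1, and these 4 extra units are
  absorbed by multiples of the predicate size, which is at least 1.\<close>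

lemma branch_size_step:
  shows "branch_size (fail_pred t b) \<le> branch_size b + 6 * cond_size t"
    and "branch_size (fail_guard t b) \<le> branch_size b + 6 * cond_size t"
    and "branch_size (enable t b) \<le> branch_size b + 6 * cond_size t"
  using psize_ge_1[of "tpred t"] csize_negc[of "tguard t"]
  by (cases b; simp add: branch_size_def)+

lemma branches2_size:
  "b \<in> branches2 act Z ts \<Longrightarrow> branch_size b \<le> 1 + 6 * (\<Sum>t\<leftarrow>ts. cond_size t)"
proof (induction ts arbitrary: b)
  case (Cons t ts)
  from Cons.prems obtain b' where "b' \<in> branches2 act Z ts" "branch_size b \<le> branch_size b' + 6 * cond_size t"
    by (cases rule: branches2_ConsE) (use branch_size_step trans_le_add1 in blast)+
  with Cons.IH[of b'] show ?case by (simp add: algebra_simps)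
qed (simp add: branch_size_def)

lemma branches1_size:
  "b \<in> branches1 act ts \<Longrightarrow> branch_size b \<le> 1 + 6 * (\<Sum>t\<leftarrow>ts. cond_size t)"
proof (induction ts arbitrary: b)
  case (Cons t ts)
  from Cons.prems obtain b' where "b' \<in> branches1 act ts \<or> b' \<in> branches2 act (treset t) ts"
      "branch_size b \<le> branch_size b' + 6 * cond_size t"
    by (cases rule: branches1_ConsE) (use branch_size_step trans_le_add1 in blast)+
  with Cons.IH[of b'] branches2_size[of b' act "treset t" ts] show ?case
    by (auto simp: algebra_simps)
qed simp

section \<open>Counting branches\<close>

definition same_reset :: "'z set \<Rightarrow> ('q, 'b, 'x, 'z) trans list \<Rightarrow> nat" where
  "same_reset Z ts = length (filter (\<lambda>t. treset t = Z) ts)"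

text \<open>The two failing cases double the count, and the enabling case starts phase two. Its
  exponent counts all later transitions with the same reset set, whatever their label, which
  overestimates the branching.\<close>

fun branch_bound :: "'x set \<Rightarrow> ('q, 'b, 'x, 'z) trans list \<Rightarrow> nat" where
  "branch_bound L [] = 0"
| "branch_bound L (t # ts) =
     (if tlab t = L then 2 * branch_bound L ts + 3 ^ same_reset (treset t) ts else branch_bound L ts)"

lemma finite_branches2 [simp]: "finite (branches2 act Z ts)"
  by (induction ts) (auto simp: Let_def)

lemma finite_branches1 [simp]: "finite (branches1 act ts)"
  by (induction ts) (auto simp: Let_def)

lemma card_three_images:
  assumes "finite A" "finite B" "finite C"
  shows "card (f ` A \<union> g ` B \<union> h ` C) \<le> card A + card B + card C"
  by (meson add_mono assms card_Un_le card_image_le order_trans)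

lemma card_branches2: "card (branches2 act Z ts) \<le> 3 ^ same_reset Z ts"
proof (induction ts)
  case (Cons t ts)
  have "card (fail_pred t ` branches2 act Z ts \<union> fail_guard t ` branches2 act Z ts \<union>
      enable t ` branches2 act Z ts) \<le> 3 * card (branches2 act Z ts)"
    using card_three_images[of "branches2 act Z ts" "branches2 act Z ts" "branches2 act Z ts"
        "fail_pred t" "fail_guard t" "enable t"] by simp
  with Cons.IH show ?case
    by (auto simp: Let_def same_reset_def)
qed (simp add: same_reset_def)

lemma card_branches1:
  assumes "\<And>t. act t \<Longrightarrow> tlab t = L"
  shows "card (branches1 act ts) \<le> branch_bound L ts"
proof (induction ts)
  case (Cons t ts)
  have "card (fail_pred t ` branches1 act ts \<union> fail_guard t ` branches1 act ts \<union>
      enable t ` branches2 act (treset t) ts) \<le>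
      2 * card (branches1 act ts) + card (branches2 act (treset t) ts)"
    using card_three_images[of "branches1 act ts" "branches1 act ts" "branches2 act (treset t) ts"
        "fail_pred t" "fail_guard t" "enable t"]
    by simp
  with Cons.IH card_branches2[of act "treset t" ts] assms[of t] show ?case
    by (auto simp: Let_def)
qed simp

text \<open>The transitions resetting \<open>Z\<close> contribute at most one reset set together,
  and every other transition at most one each.\<close>

lemma card_resets_le: "card (treset ` set ts) + same_reset Z ts \<le> length ts + 1"
proof (induction ts)
  case (Cons t ts)
  show ?case
  proof (cases "treset t = Z \<and> same_reset Z ts > 0")
    case True
    then have "treset t \<in> treset ` set ts"
      by (auto simp: same_reset_def filter_empty_conv)
    with Cons True show ?thesis by (simp add: same_reset_def insert_absorb)
  next
    case False
    have "card (treset ` set (t # ts)) \<le> card (treset ` set ts) + 1"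
      by (simp add: card_insert_if)
    moreover have "card (treset ` set ts) \<le> length ts"
      using card_image_le[of "set ts" treset] card_length[of ts] by simp
    ultimately show ?thesis
      using Cons False by (auto simp: same_reset_def)
  qed
qed (simp add: same_reset_def)

text \<open>Each factor 3 costs one of the \<open>n\<close> available factors 2. Since
  \<open>n = m + 1\<close>, one factor 2 is left over, and the other \<open>m - c\<close> of them
  are replaced by factors 3.\<close>

lemma two_three_power_le:
  assumes "a + c \<le> n" "c \<le> m" "n = m + (1::nat)"
  shows "2 ^ a * 3 ^ c \<le> (2::nat) * 3 ^ m"
proof -
  have "(2::nat) ^ a * 3 ^ c \<le> 2 ^ (n - c) * 3 ^ c"
    using assms by (intro mult_right_mono power_increasing) auto
  also have "n - c = Suc (m - c)" using assms by simp
  also have "(2::nat) ^ Suc (m - c) * 3 ^ c = 2 * (2 ^ (m - c) * 3 ^ c)" by simp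
  also have "\<dots> \<le> 2 * (3 ^ (m - c) * 3 ^ c)"
    by (intro mult_left_mono mult_right_mono power_mono) auto
  also have "\<dots> = 2 * 3 ^ m" using assms by (simp flip: power_add)
  finally show ?thesis .
qed

text \<open>Writing F for the first product and N for the length, one more transition gives at most
  4 F + 2 * 3^N, and 2 * (4^N - 3^N) solves this recurrence with equality. The subtracted term
  stands on the left to avoid subtraction of natural numbers.\<close>

lemma sum_branch_bound_le:
  assumes "finite M"
  shows "2 ^ card (treset ` set ts) * (\<Sum>L\<in>M. branch_bound L ts) + 2 * 3 ^ length ts
    \<le> 2 * 4 ^ length ts"
proof (induction ts)
  case (Cons t ts)
  let ?K = "card (treset ` set ts)" and ?K' = "card (treset ` set (t # ts))"
  let ?G = "\<Sum>L\<in>M. branch_bound L ts" and ?c = "same_reset (treset t) ts"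
  have K': "?K' \<le> Suc ?K" by (simp add: card_insert_if)
  \<comment> \<open>Only the label of \<open>t\<close> acquires a phase-two term, so summing over
    all labels adds the power of 3 at most once.\<close>
  have "(\<Sum>L\<in>M. branch_bound L (t # ts)) \<le>
      (\<Sum>L\<in>M. 2 * branch_bound L ts + (if L = tlab t then 3 ^ ?c else 0))"
    by (intro sum_mono) auto
  also have "\<dots> \<le> 2 * ?G + 3 ^ ?c"
    using assms by (simp add: sum.distrib sum_distrib_left)
  finally have "2 ^ ?K' * (\<Sum>L\<in>M. branch_bound L (t # ts)) \<le> 2 ^ ?K' * (2 * ?G + 3 ^ ?c)"
    by simp
  also have "\<dots> = 2 ^ ?K' * (2 * ?G) + 2 ^ ?K' * 3 ^ ?c"
    by (simp add: algebra_simps)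
  also have "2 ^ ?K' * (2 * ?G) \<le> 2 ^ Suc ?K * (2 * ?G)"
    using K' by (intro mult_right_mono power_increasing) auto
  also have "2 ^ ?K' * 3 ^ ?c \<le> (2::nat) * 3 ^ length ts"
  proof (rule two_three_power_le)
    \<comment> \<open>Applied to the longer list, \<open>card_resets_le\<close> counts
      \<open>t\<close> itself as well; this extra unit cancels its summand 1.\<close>
    show "?K' + ?c \<le> length (t # ts)"
      using card_resets_le[of "t # ts" "treset t"] by (simp add: same_reset_def)
    show "?c \<le> length ts" by (simp add: same_reset_def)
  qed simp
  finally have "2 ^ ?K' * (\<Sum>L\<in>M. branch_bound L (t # ts)) \<le> 4 * (2 ^ ?K * ?G) + 2 * 3 ^ length ts"
    by (simp add: algebra_simps)
  with Cons.IH show ?case by (simp del: branch_bound.simps)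
qed simp

section \<open>Reachable configurations\<close>

text \<open>Configurations before position \<open>k\<close> is read, with the labels prescribed by
  \<open>lab\<close>. Fixing the labels collects exactly the runs that synchrony compares.\<close>

inductive reach :: "('b \<Rightarrow> 'e set) \<Rightarrow> ('q, 'b, 'x, 'z) tcea \<Rightarrow> 'e tstream \<Rightarrow> nat \<Rightarrow> (nat \<Rightarrow> 'x set)
    \<Rightarrow> nat \<Rightarrow> 'q \<Rightarrow> 'z valuation \<Rightarrow> bool"
  for bs T S i lab where
  start: "1 \<le> i \<Longrightarrow> reach bs T S i lab i (init T) (\<lambda>_. None)"
| step: "\<lbrakk>reach bs T S i lab k q \<nu>; k \<le> length S; t \<in> delta T; tsrc t = q; tlab t = lab k;
    enabled bs (ev S k) (vplus \<nu> (dt S k)) t\<rbrakk>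
    \<Longrightarrow> reach bs T S i lab (Suc k) (ttgt t) (vreset (treset t) (vplus \<nu> (dt S k)))"

lemma reach_ge: "reach bs T S i lab k q \<nu> \<Longrightarrow> 1 \<le> i \<and> i \<le> k"
  by (induction rule: reach.induct) auto

lemma run_reach:
  assumes "is_run bs T S i j qs vs ts" and "\<forall>k\<in>{i..j}. tlab (ts k) = lab k" and "i \<le> k" "k \<le> Suc j"
  shows "reach bs T S i lab k (qs k) (vs k)"
  using assms(3,4)
proof (induction k rule: dec_induct)
  case base
  have "qs i = init T" "vs i = (\<lambda>_. None)" "1 \<le> i" using assms(1) by (auto simp: is_run_def)
  then show ?case by (simp add: reach.start)
next
  case (step k)
  then have k: "k \<in> {i..j}" by simp
  have r: "ts k \<in> delta T" "tsrc (ts k) = qs k" "ttgt (ts k) = qs (Suc k)"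
      "enabled bs (ev S k) (vplus (vs k) (dt S k)) (ts k)"
      "vs (Suc k) = vreset (treset (ts k)) (vplus (vs k) (dt S k))" "k \<le> length S"
    using assms(1) k by (auto simp: is_run_def enabled_def)
  have "reach bs T S i lab (Suc k) (ttgt (ts k)) (vreset (treset (ts k)) (vplus (vs k) (dt S k)))"
    using step k r assms(2) by (intro reach.step) auto
  then show ?case using r by simp
qed

text \<open>Unlike \<open>is_run\<close> this admits the empty run \<open>k = i\<close>, which
  serves as the base case.\<close>

definition run_upto :: "('b \<Rightarrow> 'e set) \<Rightarrow> ('q, 'b, 'x, 'z) tcea \<Rightarrow> 'e tstream \<Rightarrow> nat \<Rightarrow> nat \<Rightarrow>
    (nat \<Rightarrow> 'q) \<Rightarrow> (nat \<Rightarrow> 'z valuation) \<Rightarrow> (nat \<Rightarrow> ('q, 'b, 'x, 'z) trans) \<Rightarrow> bool" where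
  "run_upto bs T S i k qs vs ts \<longleftrightarrow> qs i = init T \<and> vs i = (\<lambda>_. None) \<and>
     (\<forall>m\<in>{i..<k}. ts m \<in> delta T \<and> tsrc (ts m) = qs m \<and> ttgt (ts m) = qs (Suc m) \<and>
        enabled bs (ev S m) (vplus (vs m) (dt S m)) (ts m) \<and>
        vs (Suc m) = vreset (treset (ts m)) (vplus (vs m) (dt S m)))"

lemma is_run_upto:
  "is_run bs T S i j qs vs ts \<longleftrightarrow>
     1 \<le> i \<and> i \<le> j \<and> j \<le> length S \<and> run_upto bs T S i (Suc j) qs vs ts"
  unfolding is_run_def run_upto_def enabled_def atLeastLessThanSuc_atLeastAtMost by blast

lemma run_upto_extend:
  assumes "run_upto bs T S i k qs vs ts" and "i \<le> k" and "t \<in> delta T" and "tsrc t = qs k"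
    and "enabled bs (ev S k) (vplus (vs k) (dt S k)) t"
  shows "run_upto bs T S i (Suc k) (qs(Suc k := ttgt t))
    (vs(Suc k := vreset (treset t) (vplus (vs k) (dt S k)))) (ts(k := t))"
  using assms by (auto simp: run_upto_def less_Suc_eq)

lemma reach_run_upto:
  assumes "reach bs T S i lab k q \<nu>"
  shows "\<exists>qs vs ts. run_upto bs T S i k qs vs ts \<and> qs k = q \<and> vs k = \<nu> \<and>
    (\<forall>m\<in>{i..<k}. tlab (ts m) = lab m)"
  using assms
proof (induction rule: reach.induct)
  case start
  show ?case
    by (rule exI[of _ "\<lambda>_. init T"], rule exI[of _ "\<lambda>_ _. None"]) (simp add: run_upto_def)
next
  case (step k q \<nu> t)
  then obtain qs vs ts where r: "run_upto bs T S i k qs vs ts" "qs k = q" "vs k = \<nu>"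
      "\<forall>m\<in>{i..<k}. tlab (ts m) = lab m"
    by blast
  have "i \<le> k" using reach_ge[OF step.hyps(1)] by simp
  then have "run_upto bs T S i (Suc k) (qs(Suc k := ttgt t))
    (vs(Suc k := vreset (treset t) (vplus \<nu> (dt S k)))) (ts(k := t))"
    using run_upto_extend[of bs T S i k qs vs ts t] r step.hyps by simp
  moreover have "\<forall>m\<in>{i..<Suc k}. tlab ((ts(k := t)) m) = lab m"
    using r(4) step.hyps by (auto simp: less_Suc_eq)
  ultimately show ?case by (metis fun_upd_same)
qed

text \<open>Synchrony speaks of whole runs, so a single step is completed to a run that ends with
  the chosen transition.\<close>

lemma reach_step_run:
  assumes "reach bs T S i lab k q \<nu>" "k \<le> length S" "t \<in> delta T" "tsrc t = q" "tlab t = lab k"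
    "enabled bs (ev S k) (vplus \<nu> (dt S k)) t"
  shows "\<exists>qs vs ts. is_run bs T S i k qs vs ts \<and> (\<forall>m\<in>{i..k}. tlab (ts m) = lab m) \<and> ts k = t \<and>
    qs (Suc k) = ttgt t"
proof -
  obtain qs vs ts where r: "run_upto bs T S i k qs vs ts" "qs k = q" "vs k = \<nu>"
      "\<forall>m\<in>{i..<k}. tlab (ts m) = lab m"
    using reach_run_upto[OF assms(1)] by blast
  have ik: "1 \<le> i" "i \<le> k" using reach_ge[OF assms(1)] by simp_all
  let ?qs = "qs(Suc k := ttgt t)" and ?vs = "vs(Suc k := vreset (treset t) (vplus \<nu> (dt S k)))"
    and ?ts = "ts(k := t)"
  have "is_run bs T S i k ?qs ?vs ?ts"
    using run_upto_extend[of bs T S i k qs vs ts t] r assms ik by (simp add: is_run_upto)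
  moreover have "\<forall>m\<in>{i..k}. tlab (?ts m) = lab m"
    using r(4) assms(5) by auto
  ultimately show ?thesis by (metis fun_upd_same)
qed

text \<open>Equality of semantics thus reduces to reaching final states along the same label
  sequences.\<close>

lemma sem_iff_reach:
  "(i, j, \<mu>) \<in> sem bs T S \<longleftrightarrow> i \<le> j \<and> (\<exists>lab. (\<exists>q \<nu>. reach bs T S i lab (Suc j) q \<nu> \<and> q \<in> final T) \<and>
     \<mu> = (\<lambda>X. {k \<in> {i..j}. X \<in> lab k}))"
proof
  assume "(i, j, \<mu>) \<in> sem bs T S"
  then obtain qs vs ts where r: "is_run bs T S i j qs vs ts" "qs (Suc j) \<in> final T"
      "\<mu> = (\<lambda>X. {k \<in> {i..j}. X \<in> tlab (ts k)})"
    by (auto simp: sem_def)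
  have "i \<le> j" using r(1) by (simp add: is_run_def)
  moreover have "reach bs T S i (\<lambda>k. tlab (ts k)) (Suc j) (qs (Suc j)) (vs (Suc j))"
    using \<open>i \<le> j\<close> by (intro run_reach[OF r(1)]) auto
  ultimately show "i \<le> j \<and> (\<exists>lab. (\<exists>q \<nu>. reach bs T S i lab (Suc j) q \<nu> \<and> q \<in> final T) \<and>
     \<mu> = (\<lambda>X. {k \<in> {i..j}. X \<in> lab k}))" using r by blast
next
  assume "i \<le> j \<and> (\<exists>lab. (\<exists>q \<nu>. reach bs T S i lab (Suc j) q \<nu> \<and> q \<in> final T) \<and>
     \<mu> = (\<lambda>X. {k \<in> {i..j}. X \<in> lab k}))"
  then obtain lab q \<nu> where ij: "i \<le> j" and r: "reach bs T S i lab (Suc j) q \<nu>" and q: "q \<in> final T"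
    and \<mu>: "\<mu> = (\<lambda>X. {k \<in> {i..j}. X \<in> lab k})" by blast
  from r obtain qs vs ts where run: "is_run bs T S i j qs vs ts" "\<forall>m\<in>{i..j}. tlab (ts m) = lab m"
      "qs (Suc j) = q"
  proof cases
    case start
    with ij show ?thesis by simp
  next
    case (step q' \<nu>' t)
    then show ?thesis using reach_step_run[of bs T S i lab j q' \<nu>' t] that by blast
  qed
  have "\<mu> = (\<lambda>X. {k \<in> {i..j}. X \<in> tlab (ts k)})" unfolding \<mu> using run(2) by auto
  with run q show "(i, j, \<mu>) \<in> sem bs T S" unfolding sem_def by blast
qed

lemma sync_reset_eq:
  fixes bs :: "'b \<Rightarrow> 'e set"
  assumes "sync_resets bs T" "valid_stream S" "k \<le> length S"
    and "reach bs T S i lab k q \<nu>" "t \<in> delta T" "tsrc t = q" "tlab t = lab k"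
      "enabled bs (ev S k) (vplus \<nu> (dt S k)) t"
    and "reach bs T S i lab k q' \<nu>'" "t' \<in> delta T" "tsrc t' = q'" "tlab t' = lab k"
      "enabled bs (ev S k) (vplus \<nu>' (dt S k)) t'"
  shows "treset t = treset t'"
proof -
  obtain qs vs ts where r: "is_run bs T S i k qs vs ts" "\<forall>m\<in>{i..k}. tlab (ts m) = lab m" "ts k = t"
    using reach_step_run[OF assms(4,3,5,6,7,8)] by blast
  obtain qs' vs' ts' where r': "is_run bs T S i k qs' vs' ts'" "\<forall>m\<in>{i..k}. tlab (ts' m) = lab m"
      "ts' k = t'"
    using reach_step_run[OF assms(9,3,10-13)] by blast
  have "\<forall>m\<in>{i..k}. tlab (ts m) = tlab (ts' m)" using r(2) r'(2) by simp
  then have "\<forall>m\<in>{i..k}. treset (ts m) = treset (ts' m)"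
    using assms(1,2) r(1) r'(1) unfolding sync_resets_def by blast
  moreover have "k \<in> {i..k}" using r(1) by (simp add: is_run_def)
  ultimately show ?thesis using r(3) r'(3) by blast
qed

text \<open>Clock values depend only on the timestamps and the resets performed, and synchrony makes
  the resets a function of the labels. Hence one valuation serves a whole set of states.\<close>

lemma sync_valuation_unique:
  fixes bs :: "'b \<Rightarrow> 'e set"
  assumes "sync_resets bs T" "valid_stream S"
    and "reach bs T S i lab k q \<nu>" "reach bs T S i lab k q' \<nu>'"
  shows "\<nu> = \<nu>'"
  using assms(3,4)
proof (induction arbitrary: q' \<nu>' rule: reach.induct)
  case start
  from start(2) show ?case
  proof cases
    case (step k)
    then show ?thesis using reach_ge by fastforce
  qed simp
next
  case (step k q \<nu> t)
  from step.prems show ?case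
  proof cases
    case start
    then show ?thesis using reach_ge[OF step.hyps(1)] by simp
  next
    case (step q2 \<nu>2 t2)
    then have "\<nu> = \<nu>2" using step.IH by blast
    moreover have "treset t = treset t2"
      using sync_reset_eq[OF assms(1,2) \<open>k \<le> length S\<close> \<open>reach bs T S i lab k q \<nu>\<close> \<open>t \<in> delta T\<close>
          \<open>tsrc t = q\<close> \<open>tlab t = lab k\<close> \<open>enabled bs (ev S k) (vplus \<nu> (dt S k)) t\<close>, of q2 \<nu>2 t2]
        step by blast
    ultimately show ?thesis using step by simp
  qed
qed

section \<open>The subset construction\<close>

text \<open>Candidates for the set of defined clocks, which is the union of the resets performed so
  far. Their number is bounded through the distinct reset sets; the size of \<open>T\<close> does
  not count clocks.\<close>

definition reset_unions :: "('q, 'b, 'x, 'z) tcea \<Rightarrow> 'z set set" where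
  "reset_unions T = Union ` Pow (treset ` delta T)"

text \<open>The extra element is the clock that \<open>negc\<close> uses for conditions without clocks.\<close>

definition clock_pool :: "('q, 'b, 'x, 'z) tcea \<Rightarrow> 'z set" where
  "clock_pool T = insert (SOME z. z \<in> {}) (clocks T)"

text \<open>A guard with an undefined clock cannot hold; filtering it out beforehand leaves only
  guards for which \<open>negc\<close> is a true complement.\<close>

definition active :: "'q set \<Rightarrow> 'z set \<Rightarrow> 'x set \<Rightarrow> ('q, 'b, 'x, 'z) trans \<Rightarrow> bool" where
  "active R V L t \<longleftrightarrow> tsrc t \<in> R \<and> cclocks (tguard t) \<subseteq> V \<and> tlab t = L"

definition resets :: "('q, 'b, 'x, 'z) branch \<Rightarrow> 'z set" where
  "resets b = \<Union> (treset ` snd (snd b))"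

text \<open>\<open>enc\<close> and \<open>h\<close> merely rename subset states and clocks into the
  types of the target automaton.\<close>

definition det_trans :: "('q set \<times> 'z set \<Rightarrow> 's) \<Rightarrow> ('z \<Rightarrow> 'y) \<Rightarrow> 'q set \<Rightarrow> 'z set \<Rightarrow> 'x set
    \<Rightarrow> ('q, 'b, 'x, 'z) branch \<Rightarrow> ('s, 'b, 'x, 'y) trans" where
  "det_trans enc h R V L b =
     (enc (R, V), fst b, map_ccond h (fst (snd b)), L, h ` resets b,
      enc (ttgt ` snd (snd b), V \<union> resets b))"

definition det_tcea :: "('q set \<times> 'z set \<Rightarrow> 's) \<Rightarrow> ('z \<Rightarrow> 'y) \<Rightarrow> ('q, 'b, 'x, 'z) trans list
    \<Rightarrow> ('q, 'b, 'x, 'z) tcea \<Rightarrow> ('s, 'b, 'x, 'y) tcea" where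
  "det_tcea enc h ts T = \<lparr>
     states = enc ` (Pow (states T) \<times> reset_unions T),
     vars = vars T,
     clocks = h ` clock_pool T,
     delta = (\<Union>R\<in>Pow (states T). \<Union>V\<in>reset_unions T. \<Union>L\<in>tlab ` delta T.
       det_trans enc h R V L ` branches1 (active R V L) ts),
     init = enc ({init T}, {}),
     final = enc ` ({R \<in> Pow (states T). R \<inter> final T \<noteq> {}} \<times> reset_unions T)\<rparr>"

lemma det_trans_simps [simp]:
  "tsrc (det_trans enc h R V L b) = enc (R, V)"
  "tpred (det_trans enc h R V L b) = fst b"
  "tguard (det_trans enc h R V L b) = map_ccond h (fst (snd b))"
  "tlab (det_trans enc h R V L b) = L"
  "treset (det_trans enc h R V L b) = h ` resets b"
  "ttgt (det_trans enc h R V L b) = enc (ttgt ` snd (snd b), V \<union> resets b)"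
  by (simp_all add: det_trans_def tsrc_def tpred_def tguard_def tlab_def treset_def ttgt_def)

lemma empty_in_reset_unions: "{} \<in> reset_unions T"
  unfolding reset_unions_def by (rule image_eqI[of _ _ "{}"]) auto

lemma reset_unions_Un:
  assumes "V \<in> reset_unions T" "t \<in> delta T"
  shows "V \<union> treset t \<in> reset_unions T"
proof -
  obtain \<Z> where "\<Z> \<subseteq> treset ` delta T" "V = \<Union> \<Z>"
    using assms(1) by (auto simp: reset_unions_def)
  then show ?thesis
    unfolding reset_unions_def using assms(2)
    by (intro image_eqI[of _ _ "insert (treset t) \<Z>"]) auto
qed

lemma card_reset_unions:
  assumes "finite (delta T)"
  shows "finite (reset_unions T)" "card (reset_unions T) \<le> 2 ^ card (treset ` delta T)"
  using assms card_image_le[of "Pow (treset ` delta T)" Union]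
  by (auto simp: reset_unions_def card_Pow)

locale det_construction =
  fixes bs :: "'b \<Rightarrow> 'e set" and T :: "('q, 'b, 'x, 'z) tcea"
    and ts :: "('q, 'b, 'x, 'z) trans list" and enc :: "'q set \<times> 'z set \<Rightarrow> 's" and h :: "'z \<Rightarrow> 'y"
  assumes wf: "wf_tcea T" and ts: "set ts = delta T" "distinct ts"
    and inj_enc: "inj_on enc (Pow (states T) \<times> reset_unions T)"
    and inj_h: "inj_on h (clock_pool T)"
begin

abbreviation "T' \<equiv> det_tcea enc h ts T"

lemma wf_trans:
  assumes "t \<in> delta T"
  shows "tsrc t \<in> states T" "ttgt t \<in> states T" "cclocks (tguard t) \<subseteq> clocks T"
    "\<forall>c\<in>cconsts (tguard t). c \<ge> 0" "tlab t \<subseteq> vars T" "treset t \<subseteq> clocks T"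
  using wf assms by (simp_all add: wf_tcea_def)

lemma det_deltaE:
  assumes "t' \<in> delta T'"
  obtains R V L b where "R \<subseteq> states T" "V \<in> reset_unions T" "L \<in> tlab ` delta T"
    "b \<in> branches1 (active R V L) ts" "t' = det_trans enc h R V L b"
  using assms unfolding det_tcea_def tcea.simps by blast

lemma det_deltaI:
  assumes "R \<subseteq> states T" "V \<in> reset_unions T" "L \<in> tlab ` delta T" "b \<in> branches1 (active R V L) ts"
  shows "det_trans enc h R V L b \<in> delta T'"
  unfolding det_tcea_def tcea.simps using assms by blast

lemma branchE:
  assumes "b \<in> branches1 (active R V L) ts"
  obtains t where "t \<in> snd (snd b)" "t \<in> delta T" "tlab t = L" "resets b = treset t"
    "snd (snd b) \<subseteq> delta T"
proof -
  obtain t where t: "t \<in> snd (snd b)"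
      "\<forall>t'\<in>snd (snd b). t' \<in> set ts \<and> active R V L t' \<and> treset t' = treset t"
    using branches1_transitions[OF assms] by blast
  have "treset ` snd (snd b) = {treset t}" using t by blast
  then have "resets b = treset t" by (simp add: resets_def)
  moreover have "snd (snd b) \<subseteq> delta T" using t(2) ts(1) by blast
  moreover have "tlab t = L" using t by (simp add: active_def)
  ultimately show ?thesis using t(1) by (intro that) blast+
qed

lemma branch_clocks:
  assumes "b \<in> branches1 (active R V L) ts"
  shows "cclocks (fst (snd b)) \<subseteq> clock_pool T"
  unfolding clock_pool_def by (rule branches1_clocks[OF assms]) (use ts wf_trans(3) in blast)

lemma finite_det_delta: "finite (delta T')"
  unfolding det_tcea_def tcea.simps
  using wf card_reset_unions(1)[of T] by (intro finite_UN_I finite_imageI) (simp_all add: wf_tcea_def)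

lemma det_wf: "wf_tcea T'"
proof -
  have fin: "finite (states T)" "finite (delta T)" "finite (vars T)" "finite (clocks T)"
    "init T \<in> states T"
    using wf by (auto simp: wf_tcea_def)
  have "tsrc t' \<in> states T' \<and> ttgt t' \<in> states T' \<and> cclocks (tguard t') \<subseteq> clocks T' \<and>
      (\<forall>c\<in>cconsts (tguard t'). c \<ge> 0) \<and> tlab t' \<subseteq> vars T' \<and> treset t' \<subseteq> clocks T'"
    if "t' \<in> delta T'" for t'
  proof -
    from that obtain R V L b where *: "R \<subseteq> states T" "V \<in> reset_unions T" "L \<in> tlab ` delta T"
        "b \<in> branches1 (active R V L) ts" and t': "t' = det_trans enc h R V L b"
      by (rule det_deltaE)
    obtain t where t: "t \<in> snd (snd b)" "t \<in> delta T" "tlab t = L" "resets b = treset t"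
        "snd (snd b) \<subseteq> delta T"
      using *(4) by (rule branchE)
    have "V \<union> resets b \<in> reset_unions T"
      using reset_unions_Un[OF *(2) t(2)] t(4) by simp
    moreover have "ttgt ` snd (snd b) \<subseteq> states T" using t(5) wf_trans(2) by blast
    moreover have "cclocks (fst (snd b)) \<subseteq> clock_pool T" using *(4) by (rule branch_clocks)
    moreover have "\<forall>c\<in>cconsts (fst (snd b)). c \<ge> 0"
      by (rule branches1_consts[OF *(4)]) (use ts wf_trans(4) in blast)
    moreover have "resets b \<subseteq> clock_pool T" "L \<subseteq> vars T"
      using t wf_trans[OF t(2)] by (auto simp: clock_pool_def)
    ultimately show ?thesis
      using *(1,2) unfolding t' by (auto simp: det_tcea_def)
  qed
  moreover have "finite (clocks T')" "finite (vars T')" "finite (states T')"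
    using fin card_reset_unions(1)[of T] by (simp_all add: det_tcea_def clock_pool_def)
  moreover have "init T' \<in> states T'" "final T' \<subseteq> states T'"
    using fin empty_in_reset_unions[of T] by (auto simp: det_tcea_def)
  ultimately show ?thesis
    unfolding wf_tcea_def using finite_det_delta by blast
qed

text \<open>Injectivity of \<open>enc\<close> and equal labels place both branches in the same tree.
  A common valuation of the renamed guards, composed with \<open>h\<close>, makes both branches
  hold, so \<open>branches1_unique\<close> identifies them.\<close>

lemma det_deterministic: "deterministic bs T'"
  unfolding deterministic_def
proof (intro ballI impI notI)
  fix t1 t2
  assume t: "t1 \<in> delta T'" "t2 \<in> delta T'" and lab: "tlab t1 = tlab t2"
    and asm: "t1 \<noteq> t2 \<and> tsrc t1 = tsrc t2 \<and> psem bs (tpred t1) \<inter> psem bs (tpred t2) \<noteq> {} \<and>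
      csatisfiable (CAnd (tguard t1) (tguard t2))"
  from t(1) obtain R V L b where 1: "R \<subseteq> states T" "V \<in> reset_unions T"
      "b \<in> branches1 (active R V L) ts" "t1 = det_trans enc h R V L b"
    by (rule det_deltaE)
  from t(2) obtain R2 V2 L2 b2 where 2: "R2 \<subseteq> states T" "V2 \<in> reset_unions T"
      "b2 \<in> branches1 (active R2 V2 L2) ts" "t2 = det_trans enc h R2 V2 L2 b2"
    by (rule det_deltaE)
  have "enc (R, V) = enc (R2, V2)" using asm 1 2 by simp
  then have eq: "R2 = R" "V2 = V" using inj_onD[OF inj_enc, of "(R, V)" "(R2, V2)"] 1 2 by auto
  have L: "L2 = L" using lab 1 2 by simp
  obtain e where e: "e \<in> psem bs (fst b)" "e \<in> psem bs (fst b2)" using asm 1 2 by auto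
  obtain \<nu> where "csat \<nu> (map_ccond h (fst (snd b)))" "csat \<nu> (map_ccond h (fst (snd b2)))"
    using asm 1 2 by (auto simp: csatisfiable_def)
  then have "holds bs e (\<nu> \<circ> h) b" "holds bs e (\<nu> \<circ> h) b2"
    using e by (auto simp: holds_def csat_map_ccond)
  then have "b = b2" by (rule branches1_unique[OF 1(3) 2(3)[unfolded eq L]])
  with asm 1(4) 2(4) eq L show False by simp
qed

section \<open>Simulation between the two automata\<close>

lemma reach_states: "reach bs T S i lab k q \<nu> \<Longrightarrow> q \<in> states T"
  by (induction rule: reach.induct) (use wf in \<open>auto simp: wf_tcea_def\<close>)

text \<open>Restricted to \<open>clock_pool T\<close>, where \<open>h\<close> is injective. Equality
  of options also transfers definedness.\<close>

definition agree :: "'y valuation \<Rightarrow> 'z valuation \<Rightarrow> bool" where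
  "agree \<nu>' \<nu> \<longleftrightarrow> (\<forall>z\<in>clock_pool T. \<nu>' (h z) = \<nu> z)"

lemma agree_vplus: "agree \<nu>' \<nu> \<Longrightarrow> agree (vplus \<nu>' d) (vplus \<nu> d)"
  by (simp add: agree_def vplus_def)

lemma agree_vreset:
  assumes "agree \<nu>' \<nu>" "Z \<subseteq> clock_pool T"
  shows "agree (vreset (h ` Z) \<nu>') (vreset Z \<nu>)"
  using assms inj_on_image_mem_iff[OF inj_h] by (simp add: agree_def vreset_def)

lemma agree_holds:
  assumes "b \<in> branches1 (active R V L) ts" "agree \<nu>' \<nu>"
  shows "e \<in> psem bs (fst b) \<and> csat \<nu>' (map_ccond h (fst (snd b))) \<longleftrightarrow> holds bs e \<nu> b"
proof -
  have "csat (\<nu>' \<circ> h) (fst (snd b)) \<longleftrightarrow> csat \<nu> (fst (snd b))"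
    using branch_clocks[OF assms(1)] assms(2) by (intro csat_cong) (auto simp: agree_def)
  then show ?thesis by (simp add: csat_map_ccond holds_def)
qed

definition reachable :: "'e tstream \<Rightarrow> nat \<Rightarrow> (nat \<Rightarrow> 'x set) \<Rightarrow> nat \<Rightarrow> 'q set" where
  "reachable S i lab k = {q. \<exists>\<nu>. reach bs T S i lab k q \<nu>}"

definition simulates :: "'e tstream \<Rightarrow> nat \<Rightarrow> (nat \<Rightarrow> 'x set) \<Rightarrow> nat \<Rightarrow> 's \<Rightarrow> 'y valuation
    \<Rightarrow> 'z valuation \<Rightarrow> bool" where
  "simulates S i lab k s \<nu>' \<nu> \<longleftrightarrow> s = enc (reachable S i lab k, dom \<nu>) \<and> dom \<nu> \<in> reset_unions T \<and>
     (\<exists>q. reach bs T S i lab k q \<nu>) \<and> agree \<nu>' \<nu>"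

context
  fixes S :: "'e tstream" and i :: nat and lab :: "nat \<Rightarrow> 'x set"
  assumes sync: "sync_resets bs T" and valid: "valid_stream S"
begin

lemma reachable_subset: "reachable S i lab k \<subseteq> states T"
  by (auto simp: reachable_def reach_states)

lemma reachable_valuation:
  assumes "simulates S i lab k s \<nu>' \<nu>"
  shows "q \<in> reachable S i lab k \<longleftrightarrow> reach bs T S i lab k q \<nu>"
  using assms sync_valuation_unique[OF sync valid] unfolding simulates_def reachable_def by blast

text \<open>Being enabled already requires defined guard clocks, and the passage of time keeps the
  domain, so the clock test in \<open>active\<close> loses no step.\<close>

lemma active_enabled_iff:
  assumes "simulates S i lab k s \<nu>' \<nu>"
  shows "active (reachable S i lab k) (dom \<nu>) (lab k) t \<and> enabled bs (ev S k) (vplus \<nu> (dt S k)) t \<longleftrightarrow>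
    reach bs T S i lab k (tsrc t) \<nu> \<and> tlab t = lab k \<and> enabled bs (ev S k) (vplus \<nu> (dt S k)) t"
  using reachable_valuation[OF assms] by (auto simp: active_def enabled_def csat_def)

text \<open>By synchrony and \<open>branches1_sound\<close>, the branch collects exactly the
  transitions with label \<open>lab k\<close> that can fire from reachable configurations. Their
  targets therefore form the next reachable set.\<close>

lemma branch_step:
  assumes sim: "simulates S i lab k s \<nu>' \<nu>" and k: "k \<le> length S"
    and b: "b \<in> branches1 (active (reachable S i lab k) (dom \<nu>) (lab k)) ts"
    and holds: "holds bs (ev S k) (vplus \<nu> (dt S k)) b"
  shows "simulates S i lab (Suc k) (enc (ttgt ` snd (snd b), dom \<nu> \<union> resets b))
    (vreset (h ` resets b) (vplus \<nu>' (dt S k))) (vreset (resets b) (vplus \<nu> (dt S k)))"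
proof -
  let ?en = "enabled bs (ev S k) (vplus \<nu> (dt S k))"
  let ?act = "active (reachable S i lab k) (dom \<nu>) (lab k)"
  have resets_eq: "treset t = treset t'"
    if "t \<in> set ts" "t' \<in> set ts" "?act t" "?act t'" "?en t" "?en t'" for t t'
    using sync_reset_eq[OF sync valid k, of i lab "tsrc t" \<nu> t "tsrc t'" \<nu> t']
      active_enabled_iff[OF sim, of t] active_enabled_iff[OF sim, of t'] that ts(1) by simp
  have "snd (snd b) = {t \<in> set ts. ?act t \<and> ?en t}"
    by (rule branches1_sound[OF b holds]) (rule resets_eq)
  then have D: "snd (snd b) = {t \<in> delta T. reach bs T S i lab k (tsrc t) \<nu> \<and> tlab t = lab k \<and> ?en t}"
    unfolding active_enabled_iff[OF sim] ts(1) .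
  obtain t where t: "t \<in> snd (snd b)" "t \<in> delta T" "resets b = treset t"
    using b by (rule branchE)
  have reach_t: "reach bs T S i lab (Suc k) (ttgt t') (vreset (resets b) (vplus \<nu> (dt S k)))"
    if "t' \<in> snd (snd b)" for t'
  proof -
    have "treset t' = resets b"
      using sync_reset_eq[OF sync valid k, of i lab "tsrc t'" \<nu> t' "tsrc t" \<nu> t] that t D by simp
    then show ?thesis using reach.step[of bs T S i lab k "tsrc t'" \<nu> t'] that k D by simp
  qed
  have "reachable S i lab (Suc k) = ttgt ` snd (snd b)"
  proof
    show "ttgt ` snd (snd b) \<subseteq> reachable S i lab (Suc k)"
      unfolding reachable_def using reach_t by blast
    show "reachable S i lab (Suc k) \<subseteq> ttgt ` snd (snd b)"
    proof
      fix q assume "q \<in> reachable S i lab (Suc k)"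
      then obtain \<nu>2 where "reach bs T S i lab (Suc k) q \<nu>2" by (auto simp: reachable_def)
      then show "q \<in> ttgt ` snd (snd b)"
      proof cases
        case start
        moreover obtain q' where "reach bs T S i lab k q' \<nu>" using sim by (auto simp: simulates_def)
        ultimately show ?thesis using reach_ge[of bs T S i lab k q' \<nu>] by simp
      next
        case (step q1 \<nu>1 t1)
        obtain q' where "reach bs T S i lab k q' \<nu>" using sim by (auto simp: simulates_def)
        \<comment> \<open>An arbitrary predecessor carries the common valuation, so its transition
          belongs to the branch.\<close>
        with step have "\<nu>1 = \<nu>" using sync_valuation_unique[OF sync valid] by blast
        with step D show ?thesis by simp
      qed
    qed
  qed
  moreover have "dom \<nu> \<union> resets b \<in> reset_unions T"
    using sim t reset_unions_Un[of "dom \<nu>" T t] by (simp add: simulates_def)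
  moreover have "resets b \<subseteq> clock_pool T"
    using t(3) wf_trans(6)[OF t(2)] by (auto simp: clock_pool_def)
  moreover have "agree \<nu>' \<nu>" using sim by (simp add: simulates_def)
  ultimately show ?thesis
    unfolding simulates_def dom_vreset dom_vplus
    using reach_t[OF t(1)] by (intro conjI exI agree_vreset agree_vplus) simp_all
qed

lemma det_reach_sound:
  assumes "reach bs T' S i lab k s \<nu>'"
  shows "\<exists>\<nu>. simulates S i lab k s \<nu>' \<nu>"
  using assms
proof (induction rule: reach.induct)
  case start
  have "reachable S i lab i = {init T}"
  proof
    show "reachable S i lab i \<subseteq> {init T}"
    proof
      fix q assume "q \<in> reachable S i lab i"
      then obtain \<nu> where "reach bs T S i lab i q \<nu>" by (auto simp: reachable_def)
      then show "q \<in> {init T}"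
      proof cases
        case (step k)
        then show ?thesis using reach_ge by fastforce
      qed simp
    qed
    show "{init T} \<subseteq> reachable S i lab i"
      using start reach.start[of i bs T S lab] by (auto simp: reachable_def)
  qed
  then have "simulates S i lab i (init T') (\<lambda>_. None) (\<lambda>_. None)"
    using start reach.start[of i bs T S lab] empty_in_reset_unions[of T]
    by (auto simp: simulates_def agree_def det_tcea_def)
  then show ?case by blast
next
  case (step k s \<nu>' t')
  then obtain \<nu> where sim: "simulates S i lab k s \<nu>' \<nu>" by blast
  from step.hyps(3) obtain R V L b where *: "R \<subseteq> states T" "V \<in> reset_unions T"
      "b \<in> branches1 (active R V L) ts" "t' = det_trans enc h R V L b"
    by (rule det_deltaE)
  have "enc (R, V) = enc (reachable S i lab k, dom \<nu>)" "dom \<nu> \<in> reset_unions T"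
    using sim step.hyps(4) *(4) by (simp_all add: simulates_def)
  then have RV: "R = reachable S i lab k" "V = dom \<nu>"
    using inj_onD[OF inj_enc, of "(R, V)" "(reachable S i lab k, dom \<nu>)"] *(1,2) reachable_subset
    by auto
  have L: "L = lab k" using step.hyps(5) *(4) by simp
  have "agree (vplus \<nu>' (dt S k)) (vplus \<nu> (dt S k))"
    using sim agree_vplus by (simp add: simulates_def)
  then have "holds bs (ev S k) (vplus \<nu> (dt S k)) b"
    using agree_holds[OF *(3)] step.hyps(6) *(4) by (simp add: enabled_def)
  from branch_step[OF sim step.hyps(2) *(3)[unfolded RV L] this] show ?case
    unfolding *(4) RV by auto
qed

text \<open>Mere existence suffices: \<open>det_reach_sound\<close> determines the shape of the
  configuration, and the step of \<open>T\<close> supplies the enabled transition that a branch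
  requires.\<close>

lemma det_reach_complete:
  assumes "reach bs T S i lab k q \<nu>"
  shows "\<exists>s \<nu>'. reach bs T' S i lab k s \<nu>'"
  using assms
proof (induction rule: reach.induct)
  case start
  then show ?case by (blast intro: reach.start)
next
  case (step k q \<nu> t)
  then obtain s \<nu>' where r: "reach bs T' S i lab k s \<nu>'" by blast
  then obtain \<nu>2 where sim2: "simulates S i lab k s \<nu>' \<nu>2" using det_reach_sound by blast
  then have "\<nu>2 = \<nu>"
    using sync_valuation_unique[OF sync valid] step.hyps(1) by (auto simp: simulates_def)
  with sim2 have sim: "simulates S i lab k s \<nu>' \<nu>" by simp
  let ?act = "active (reachable S i lab k) (dom \<nu>) (lab k)"
  have "?act t" "enabled bs (ev S k) (vplus \<nu> (dt S k)) t"
    using active_enabled_iff[OF sim, of t] step.hyps by simp_all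
  moreover have "cclocks (tguard t) \<subseteq> dom (vplus \<nu> (dt S k))" if "?act t"
    for t :: "('q, 'b, 'x, 'z) trans"
    using that by (simp add: active_def)
  ultimately obtain b where b: "b \<in> branches1 ?act ts" "holds bs (ev S k) (vplus \<nu> (dt S k)) b"
    using branches1_complete[of ts ?act "vplus \<nu> (dt S k)" bs "ev S k"] step.hyps(3) ts(1) by blast
  let ?t' = "det_trans enc h (reachable S i lab k) (dom \<nu>) (lab k) b"
  have "?t' \<in> delta T'"
    using b(1) sim reachable_subset step.hyps(3,5) by (intro det_deltaI) (auto simp: simulates_def)
  moreover have "enabled bs (ev S k) (vplus \<nu>' (dt S k)) ?t'"
    using agree_holds[OF b(1), of "vplus \<nu>' (dt S k)" "vplus \<nu> (dt S k)" "ev S k"] b(2) sim agree_vplus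
    by (simp add: simulates_def enabled_def)
  moreover have "tsrc ?t' = s" using sim by (simp add: simulates_def)
  ultimately have "reach bs T' S i lab (Suc k) (ttgt ?t') (vreset (treset ?t') (vplus \<nu>' (dt S k)))"
    by (intro reach.step[OF r step.hyps(2)]) simp_all
  then show ?case by blast
qed

lemma final_iff:
  assumes "simulates S i lab k s \<nu>' \<nu>"
  shows "s \<in> final T' \<longleftrightarrow> reachable S i lab k \<inter> final T \<noteq> {}"
proof
  let ?R = "reachable S i lab k"
  have s: "s = enc (?R, dom \<nu>)" "dom \<nu> \<in> reset_unions T"
    using assms by (auto simp: simulates_def)
  show "?R \<inter> final T \<noteq> {}" if "s \<in> final T'"
  proof -
    from that obtain R V where *: "R \<subseteq> states T" "R \<inter> final T \<noteq> {}" "V \<in> reset_unions T" "s = enc (R, V)"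
      by (auto simp: det_tcea_def)
    then have "(?R, dom \<nu>) = (R, V)"
      using s reachable_subset by (intro inj_onD[OF inj_enc]) auto
    with *(2) show ?thesis by simp
  qed
  show "?R \<inter> final T \<noteq> {} \<Longrightarrow> s \<in> final T'"
    using s reachable_subset by (auto simp: det_tcea_def)
qed

lemma det_reach_final:
  "(\<exists>q \<nu>. reach bs T S i lab k q \<nu> \<and> q \<in> final T) \<longleftrightarrow>
   (\<exists>s \<nu>'. reach bs T' S i lab k s \<nu>' \<and> s \<in> final T')"
proof
  assume "\<exists>q \<nu>. reach bs T S i lab k q \<nu> \<and> q \<in> final T"
  then obtain q \<nu> where q: "reach bs T S i lab k q \<nu>" "q \<in> final T" by blast
  then obtain s \<nu>' where s: "reach bs T' S i lab k s \<nu>'" using det_reach_complete by blast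
  then obtain \<nu>2 where "simulates S i lab k s \<nu>' \<nu>2" using det_reach_sound by blast
  then have "s \<in> final T'" using final_iff q by (auto simp: reachable_def)
  with s show "\<exists>s \<nu>'. reach bs T' S i lab k s \<nu>' \<and> s \<in> final T'" by blast
next
  assume "\<exists>s \<nu>'. reach bs T' S i lab k s \<nu>' \<and> s \<in> final T'"
  then obtain s \<nu>' where s: "reach bs T' S i lab k s \<nu>'" "s \<in> final T'" by blast
  then obtain \<nu> where "simulates S i lab k s \<nu>' \<nu>" using det_reach_sound by blast
  then show "\<exists>q \<nu>. reach bs T S i lab k q \<nu> \<and> q \<in> final T"
    using final_iff s(2) by (auto simp: reachable_def)
qed

end

lemma det_sem:
  assumes "sync_resets bs T" "valid_stream S"
  shows "sem bs T S = sem bs T' S"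
proof -
  have "(i, j, \<mu>) \<in> sem bs T S \<longleftrightarrow> (i, j, \<mu>) \<in> sem bs T' S" for i j \<mu>
    unfolding sem_iff_reach det_reach_final[OF assms] ..
  then show ?thesis by (auto simp: set_eq_iff)
qed

section \<open>Size of the deterministic automaton\<close>

lemma card_det_delta: "card (delta T') \<le> 2 ^ card (states T) * (2 * 4 ^ card (delta T))"
proof -
  let ?RU = "reset_unions T" and ?M = "tlab ` delta T"
  have fin: "finite (Pow (states T))" "finite ?RU" "finite ?M" "finite (states T)"
    using wf card_reset_unions(1)[of T] by (auto simp: wf_tcea_def)
  have br: "card (det_trans enc h R V L ` branches1 (active R V L) ts) \<le> branch_bound L ts" for R V L
    using card_image_le[of "branches1 (active R V L) ts" "det_trans enc h R V L"]
      card_branches1[of "active R V L" L ts] by (simp add: active_def)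
  have "card (delta T') \<le> (\<Sum>R\<in>Pow (states T). \<Sum>V\<in>?RU. \<Sum>L\<in>?M. branch_bound L ts)"
    unfolding det_tcea_def tcea.simps
    by (intro order_trans[OF card_UN_le] sum_mono fin br)
  also have "\<dots> = 2 ^ card (states T) * (card ?RU * (\<Sum>L\<in>?M. branch_bound L ts))"
    using fin by (simp add: card_Pow)
  also have "card ?RU * (\<Sum>L\<in>?M. branch_bound L ts) \<le>
      2 ^ card (treset ` delta T) * (\<Sum>L\<in>?M. branch_bound L ts)"
    using wf card_reset_unions(2)[of T] by (intro mult_right_mono) (auto simp: wf_tcea_def)
  \<comment> \<open>The power of 2 from the clock sets and the branch count are bounded jointly;
    bounding them separately would lose the compensation.\<close>
  also have "\<dots> \<le> 2 * 4 ^ card (delta T)"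
    using sum_branch_bound_le[OF fin(3), of ts] ts distinct_card[of ts] by simp
  finally show ?thesis by simp
qed

lemma det_trans_size:
  assumes "t' \<in> delta T'"
  shows "csize (tguard t') + psize (tpred t') + card (tlab t') + card (treset t') \<le> 7 * tcea_size T"
proof -
  let ?sz = "\<lambda>t :: ('q, 'b, 'x, 'z) trans.
    csize (tguard t) + psize (tpred t) + card (tlab t) + card (treset t)"
  have fin: "finite (delta T)" "finite (clocks T)" "finite (states T)" "init T \<in> states T"
    using wf by (auto simp: wf_tcea_def)
  from assms obtain R V L b where b: "b \<in> branches1 (active R V L) ts"
    and t': "t' = det_trans enc h R V L b"
    by (rule det_deltaE)
  from b obtain t where t: "t \<in> delta T" "tlab t = L" "resets b = treset t"
    by (rule branchE)
  have "card (treset t') \<le> card (treset t)"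
    using t t' wf_trans(6)[OF t(1)] fin(2) by (simp add: card_image_le finite_subset)
  moreover have "branch_size b \<le> 1 + 6 * (\<Sum>t\<in>delta T. cond_size t)"
    using branches1_size[OF b] ts by (simp add: sum_list_distinct_conv_sum_set)
  moreover have "(\<Sum>t\<in>delta T. cond_size t) \<le> (\<Sum>t\<in>delta T. ?sz t)"
    by (intro sum_mono) simp
  moreover have "card L + card (treset t) \<le> (\<Sum>t\<in>delta T. ?sz t)"
    using member_le_sum[of t "delta T" ?sz] fin t by simp
  \<comment> \<open>A state pays for the summand 1 in the bound on \<open>branch_size\<close>. The
    factor 7 is 6 for the conditions plus 1 for label and resets.\<close>
  moreover have "card (states T) \<ge> 1"
    using fin by (auto simp: Suc_le_eq card_gt_0_iff)
  ultimately show ?thesis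
    unfolding tcea_size_def using t' by (simp add: branch_size_def)
qed

text \<open>15 = 1 + 2 * 7: one share for the states, and twice the exponential many transitions of
  size at most \<open>7 * tcea_size T\<close>.\<close>

lemma det_size:
  "tcea_size T' \<le> 15 * 2 ^ (card (states T) + 2 * card (delta T)) * tcea_size T"
proof -
  have fin: "finite (delta T)" "finite (states T)" "init T \<in> states T"
    using wf by (auto simp: wf_tcea_def)
  let ?E = "2 ^ card (states T) * 4 ^ card (delta T) :: nat"
  have E: "2 ^ (card (states T) + 2 * card (delta T)) = ?E"
    by (simp add: power_add power_mult)
  have "tcea_size T \<ge> card (states T)" by (simp add: tcea_size_def)
  moreover have "card (states T) \<ge> 1"
    using fin by (auto simp: Suc_le_eq card_gt_0_iff)
  ultimately have sz: "tcea_size T \<ge> 1" by simp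
  have "card (states T') \<le> card (Pow (states T) \<times> reset_unions T)"
    unfolding det_tcea_def tcea.simps
    using fin card_reset_unions(1)[OF fin(1)] by (intro card_image_le) auto
  also have "\<dots> = 2 ^ card (states T) * card (reset_unions T)"
    using fin by (simp add: card_cartesian_product card_Pow)
  also have "\<dots> \<le> 2 ^ card (states T) * 2 ^ card (treset ` delta T)"
    using card_reset_unions(2)[OF fin(1)] by simp
  also have "\<dots> \<le> 2 ^ card (states T) * 2 ^ card (delta T)"
    using fin by (simp add: card_image_le)
  also have "\<dots> \<le> ?E" by (simp add: power_mono)
  also have "\<dots> \<le> ?E * tcea_size T" using sz by simp
  finally have st: "card (states T') \<le> ?E * tcea_size T" .
  have "(\<Sum>t\<in>delta T'. csize (tguard t) + psize (tpred t) + card (tlab t) + card (treset t)) \<le>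
      card (delta T') * (7 * tcea_size T)"
    using sum_bounded_above[of "delta T'"
        "\<lambda>t. csize (tguard t) + psize (tpred t) + card (tlab t) + card (treset t)" "7 * tcea_size T"]
      det_trans_size by simp
  also have "\<dots> \<le> 2 ^ card (states T) * (2 * 4 ^ card (delta T)) * (7 * tcea_size T)"
    using card_det_delta by (intro mult_right_mono) auto
  also have "\<dots> = 14 * (?E * tcea_size T)" by simp
  finally have "tcea_size T' \<le> 15 * (?E * tcea_size T)"
    unfolding tcea_size_def[of T'] using st by simp
  then show ?thesis unfolding E by (simp add: mult.assoc)
qed

end

theorem theorem2:
  fixes bs :: "'b \<Rightarrow> 'e set"
  shows "\<exists>c :: real. \<forall>T :: ('q, 'b, 'x, 'z) tcea.
    wf_tcea T \<and> sync_resets bs T \<longrightarrow>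
    (\<exists>T' :: (nat, 'b, 'x, nat) tcea.
        wf_tcea T' \<and> deterministic bs T' \<and>
        (\<forall>S :: 'e tstream. valid_stream S \<longrightarrow> sem bs T S = sem bs T' S) \<and>
        real (tcea_size T') \<le> c * 2 ^ (card (states T) + 2 * card (delta T)) * real (tcea_size T))"
proof (intro exI[of _ 15] allI impI)
  fix T :: "('q, 'b, 'x, 'z) tcea"
  assume asm: "wf_tcea T \<and> sync_resets bs T"
  then have fin: "finite (states T)" "finite (delta T)" "finite (clocks T)"
    by (auto simp: wf_tcea_def)
  obtain ts where ts: "set ts = delta T" "distinct ts"
    using finite_distinct_list[OF fin(2)] by blast
  have "finite (Pow (states T) \<times> reset_unions T)"
    using fin card_reset_unions(1) by blast
  \<comment> \<open>Finiteness provides the injections that rename states, and below clocks, to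
    natural numbers.\<close>
  then obtain enc :: "'q set \<times> 'z set \<Rightarrow> nat" where enc: "inj_on enc (Pow (states T) \<times> reset_unions T)"
    using finite_imp_inj_to_nat_seg by blast
  have "finite (clock_pool T)" using fin by (simp add: clock_pool_def)
  then obtain h :: "'z \<Rightarrow> nat" where h: "inj_on h (clock_pool T)"
    using finite_imp_inj_to_nat_seg by blast
  interpret det_construction bs T ts enc h
    using asm ts enc h by unfold_locales auto
  have "real (tcea_size T') \<le> real (15 * 2 ^ (card (states T) + 2 * card (delta T)) * tcea_size T)"
    using det_size by (rule of_nat_mono)
  then have "real (tcea_size T') \<le> 15 * 2 ^ (card (states T) + 2 * card (delta T)) * real (tcea_size T)"
    by simp
  then show "\<exists>T' :: (nat, 'b, 'x, nat) tcea.
        wf_tcea T' \<and> deterministic bs T' \<and>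
        (\<forall>S :: 'e tstream. valid_stream S \<longrightarrow> sem bs T S = sem bs T' S) \<and>
        real (tcea_size T') \<le> 15 * 2 ^ (card (states T) + 2 * card (delta T)) * real (tcea_size T)"
    using asm by (intro exI[of _ T'] conjI det_wf det_deterministic allI impI det_sem) auto
qed

end
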